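(* Let $\Gamma$ be a countably infinite discrete group. If $X$ is a nonempty free zero-dimensional Polish $\Gamma$-space, then $\mathrm{Free}(2^\Gamma) \preccurlyeq X$, i.e., $\mathrm{Free}(2^\Gamma)$ is weakly contained in $X$. Explicitly: given any $k \in \mathbb{N}^+$, a finite subset $F \subset \Gamma$, and a continuous $k$-coloring $f \colon \mathrm{Free}(2^\Gamma) \to k$, there is a continuous $k$-coloring $g \colon X \to k$ such that $\mathscr{P}_F(X,g) = \mathscr{P}_F(\mathrm{Free}(2^\Gamma), f)$.
   Context: $k$ is identified with the discrete set $\{0,\ldots,k-1\}$; a $k$-coloring of a set is a function from it to $k$. A $\Gamma$-space is a topological space $X$ with a continuous left action $\Gamma \curvearrowright X$. It is free if the action is free, and zero-dimensional Polish if the underlying space is Polish and has a base of clopen sets. The product space $k^\Gamma$ is a $\Gamma$-space under the action $(\gamma \cdot x)(\delta) = x(\delta\gamma)$ for $x \in k^\Gamma$, $\gamma,\delta \in \Gamma$. For a $\Gamma$-space $X$, the free part $\mathrm{Free}(X)$ is the set of all $x \in X$ with trivial stabilizer, with the subspace topology and the induced action; thus $\mathrm{Free}(2^\Gamma)$ is a zero-dimensional Polish $\Gamma$-space. A $k$-pattern is a partial map $p \colon \Gamma \rightharpoonup k$ with finite domain. Given an action $\Gamma \curvearrowright X$ and $f \colon X \to k$, a $k$-pattern $p$ occurs in $f$ if there is $x \in X$ such that $f(\gamma \cdot x) = p(\gamma)$ for all $\gamma \in \mathrm{dom}(p)$. For a finite set $F \subset \Gamma$, $\mathscr{P}_F(X,f)$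 is the set of all $k$-patterns $p \colon F \to k$ with domain $F$ that occur in $f$. For zero-dimensional Polish $\Gamma$-spaces $X$, $Y$, $X$ is weakly contained in $Y$ ($X \preccurlyeq Y$) if for every $k \in \mathbb{N}^+$, finite $F \subset \Gamma$, and continuous $f \colon X \to k$, there is a continuous $g \colon Y \to k$ with $\mathscr{P}_F(Y,g) = \mathscr{P}_F(X,f)$. *)

theory Defs
  imports "HOL-Analysis.Analysis" "HOL-Algebra.Group_Action"
begin

text \<open>
  The group \<open>\<Gamma>\<close> is discrete, so joint continuity of the action is taken with respect to the
  discrete topology on its carrier.  As usual for \<^const>\<open>group_action\<close>, each \<open>\<alpha> \<gamma>\<close>
  is extensional, i.e. \<^const>\<open>undefined\<close> outside the space acted upon.
\<close>

definition gamma_space ::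
    "('g, 'm) monoid_scheme \<Rightarrow> 'x topology \<Rightarrow> ('g \<Rightarrow> 'x \<Rightarrow> 'x) \<Rightarrow> bool" where
  "gamma_space \<Gamma> X \<alpha> \<longleftrightarrow>
     group_action \<Gamma> (topspace X) \<alpha> \<and>
     continuous_map (prod_topology (discrete_topology (carrier \<Gamma>)) X) X (\<lambda>(\<gamma>, x). \<alpha> \<gamma> x)"

definition free_action ::
    "('g, 'm) monoid_scheme \<Rightarrow> 'x topology \<Rightarrow> ('g \<Rightarrow> 'x \<Rightarrow> 'x) \<Rightarrow> bool" where
  "free_action \<Gamma> X \<alpha> \<longleftrightarrow> (\<forall>x \<in> topspace X. stabilizer \<Gamma> \<alpha> x = {\<one>\<^bsub>\<Gamma>\<^esub>})"

definition polish_topology :: "'x topology \<Rightarrow> bool" where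
  "polish_topology X \<longleftrightarrow> completely_metrizable_space X \<and> separable_space X"

definition zero_dimensional :: "'x topology \<Rightarrow> bool" where
  "zero_dimensional X \<longleftrightarrow>
     (\<exists>\<B>. (\<forall>U \<in> \<B>. openin X U \<and> closedin X U) \<and>
          openin X = arbitrary union_of (\<lambda>U. U \<in> \<B>))"

definition free_part ::
    "('g, 'm) monoid_scheme \<Rightarrow> 'x topology \<Rightarrow> ('g \<Rightarrow> 'x \<Rightarrow> 'x) \<Rightarrow> 'x set" where
  "free_part \<Gamma> X \<alpha> = {x \<in> topspace X. stabilizer \<Gamma> \<alpha> x = {\<one>\<^bsub>\<Gamma>\<^esub>}}"

definition free_space ::
    "('g, 'm) monoid_scheme \<Rightarrow> 'x topology \<Rightarrow> ('g \<Rightarrow> 'x \<Rightarrow> 'x) \<Rightarrow> 'x topology" where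
  "free_space \<Gamma> X \<alpha> = subtopology X (free_part \<Gamma> X \<alpha>)"

definition induced_action ::
    "('g, 'm) monoid_scheme \<Rightarrow> 'x topology \<Rightarrow> ('g \<Rightarrow> 'x \<Rightarrow> 'x) \<Rightarrow> 'g \<Rightarrow> 'x \<Rightarrow> 'x" where
  "induced_action \<Gamma> X \<alpha> = (\<lambda>\<gamma>. \<lambda>x \<in> free_part \<Gamma> X \<alpha>. \<alpha> \<gamma> x)"

text \<open>
  The space \<open>k\<^sup>\<Gamma>\<close>: its points are the extensional functions \<open>carrier \<Gamma> \<rightarrow>\<^sub>E {..<k}\<close>.
\<close>

definition shift_space :: "('g, 'm) monoid_scheme \<Rightarrow> nat \<Rightarrow> ('g \<Rightarrow> nat) topology" where
  "shift_space \<Gamma> k = product_topology (\<lambda>_. discrete_topology {..<k}) (carrier \<Gamma>)"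

definition shift_action ::
    "('g, 'm) monoid_scheme \<Rightarrow> nat \<Rightarrow> 'g \<Rightarrow> ('g \<Rightarrow> nat) \<Rightarrow> ('g \<Rightarrow> nat)" where
  "shift_action \<Gamma> k =
     (\<lambda>\<gamma>. \<lambda>x \<in> topspace (shift_space \<Gamma> k). \<lambda>\<delta> \<in> carrier \<Gamma>. x (\<delta> \<otimes>\<^bsub>\<Gamma>\<^esub> \<gamma>))"

definition continuous_coloring :: "'x topology \<Rightarrow> nat \<Rightarrow> ('x \<Rightarrow> nat) \<Rightarrow> bool" where
  "continuous_coloring X k f \<longleftrightarrow> continuous_map X (discrete_topology {..<k}) f"

definition is_pattern :: "('g, 'm) monoid_scheme \<Rightarrow> nat \<Rightarrow> ('g \<rightharpoonup> nat) \<Rightarrow> bool" where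
  "is_pattern \<Gamma> k p \<longleftrightarrow> finite (dom p) \<and> dom p \<subseteq> carrier \<Gamma> \<and> ran p \<subseteq> {..<k}"

definition pattern_occurs ::
    "'x topology \<Rightarrow> ('g \<Rightarrow> 'x \<Rightarrow> 'x) \<Rightarrow> ('x \<Rightarrow> nat) \<Rightarrow> ('g \<rightharpoonup> nat) \<Rightarrow> bool" where
  "pattern_occurs X \<alpha> f p \<longleftrightarrow>
     (\<exists>x \<in> topspace X. \<forall>\<gamma> \<in> dom p. f (\<alpha> \<gamma> x) = the (p \<gamma>))"

definition patterns ::
    "('g, 'm) monoid_scheme \<Rightarrow> nat \<Rightarrow> 'g set \<Rightarrow> 'x topology \<Rightarrow> ('g \<Rightarrow> 'x \<Rightarrow> 'x) \<Rightarrow> ('x \<Rightarrow> nat)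
      \<Rightarrow> ('g \<rightharpoonup> nat) set" where
  "patterns \<Gamma> k F X \<alpha> f = {p. is_pattern \<Gamma> k p \<and> dom p = F \<and> pattern_occurs X \<alpha> f p}"

definition weakly_contained ::
    "('g, 'm) monoid_scheme \<Rightarrow> 'x topology \<Rightarrow> ('g \<Rightarrow> 'x \<Rightarrow> 'x)
      \<Rightarrow> 'y topology \<Rightarrow> ('g \<Rightarrow> 'y \<Rightarrow> 'y) \<Rightarrow> bool" where
  "weakly_contained \<Gamma> X \<alpha> Y \<beta> \<longleftrightarrow>
     (\<forall>k > 0. \<forall>F. finite F \<and> F \<subseteq> carrier \<Gamma> \<longrightarrow>
        (\<forall>f. continuous_coloring X k f \<longrightarrow>
           (\<exists>g. continuous_coloring Y k g \<and> patterns \<Gamma> k F Y \<beta> g = patterns \<Gamma> k F X \<alpha> f)))"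

end

theory Submission
  imports Defs "HOL-Real_Asymp.Real_Asymp"
begin

text \<open>
  A clopen set \<open>c \<subseteq> X\<close> assigns to every point \<open>x\<close> the code \<open>g \<mapsto> (g \<cdot> x \<in> c)\<close> in the Cantor space
  \<open>2\<^sup>\<Gamma>\<close>, and coding is continuous and equivariant.  The free part \<open>Fr\<close> is dense in the Cantor space,
  hence a continuous colouring \<open>f\<close> of \<open>Fr\<close> extends to an open set \<open>\<Omega>\<close> around \<open>Fr\<close>, and a pattern
  shown by the extension somewhere already occurs in \<open>f\<close>.  So if all codes lie in \<open>\<Omega>\<close>, the colouring
  of \<open>X\<close> pulled back along the coding shows only patterns of \<open>f\<close>.  It shows all of them
  if moreover a single code extends a suitable finite pattern, since the shift is topologically
  transitive and only finitely many patterns are in question.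

  To have the codes in \<open>\<Omega>\<close> they need not be free.  Enumerate the nontrivial group elements as \<open>\<gamma> n\<close> and
  let \<open>W n\<close> be finite sets.  If a code \<open>y\<close> is not free, it satisfies \<open>y w = y (w \<otimes> \<gamma> n)\<close> for some \<open>n\<close> and
  all \<open>w \<in> W n\<close>; by compactness finitely many of these clopen conditions cover the complement of
  \<open>\<Omega>\<close>.  Hence it is enough to violate finitely many of them everywhere on \<open>X\<close>, while
  realising the prescribed finite pattern at one point, provided that the windows \<open>W n\<close> are fixed beforehand
  (\<open>breaking_sets_with_prescribed_pattern\<close>).

  For this, \<open>c\<close> is built from levels of markers, the \<open>n\<close>-th level taking care of \<open>\<gamma> n\<close>.  A marker
  set is a clopen maximal sparse set, so there is a marker in a bounded window around every point.
  Around each marker, at generically chosen positions, four bits equal to 1 make the marker recognisable,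
  and further bits spell out its colour in a clopen colouring with finitely many colours that separates points
  related by the conjugates of \<open>\<gamma> n\<close> in question.  If the codes of \<open>x\<close> and of \<open>\<gamma> n \<cdot> x\<close> agreed on the
  window, they would show markers of the same colour in corresponding places \<open>w \<cdot> x\<close> and
  \<open>w \<cdot> \<gamma> n \<cdot> x\<close>, which the colouring excludes
  (\<open>marker_level_exists\<close>).  The constants of level \<open>n\<close> depend only on those of the levels below,
  whereas the marker sets themselves are constructed from the top level downwards, each level
  avoiding the much sparser positions already in use; a level is decoded after the levels
  below it have been recognised and removed (\<open>extendable_step\<close>).  So the windows do not depend on how many
  levels are used.  The prescribed pattern acts as one more level, on top of all the others.
\<close>

section \<open>Clopen independent sets and clopen colourings for free actions\<close>

definition clopenin :: "'x topology \<Rightarrow> 'x set \<Rightarrow> bool" where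
  "clopenin X U \<longleftrightarrow> openin X U \<and> closedin X U"

lemma clopenin_subset: "clopenin X U \<Longrightarrow> U \<subseteq> topspace X"
  by (simp add: clopenin_def openin_subset)

lemma clopenin_empty [simp]: "clopenin X {}"
  by (simp add: clopenin_def)

lemma clopenin_topspace [simp]: "clopenin X (topspace X)"
  by (simp add: clopenin_def)

lemma clopenin_Un: "clopenin X U \<Longrightarrow> clopenin X V \<Longrightarrow> clopenin X (U \<union> V)"
  by (auto simp: clopenin_def)

lemma clopenin_Int: "clopenin X U \<Longrightarrow> clopenin X V \<Longrightarrow> clopenin X (U \<inter> V)"
  by (auto simp: clopenin_def)

lemma clopenin_Diff: "clopenin X U \<Longrightarrow> clopenin X V \<Longrightarrow> clopenin X (U - V)"
  by (auto simp: clopenin_def)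

lemma clopenin_UN:
  "finite I \<Longrightarrow> (\<And>i. i \<in> I \<Longrightarrow> clopenin X (U i)) \<Longrightarrow> clopenin X (\<Union>i\<in>I. U i)"
  by (induction I rule: finite_induct) (auto intro: clopenin_Un)

lemma clopenin_preimage:
  "continuous_map X Y f \<Longrightarrow> clopenin Y U \<Longrightarrow> clopenin X {x \<in> topspace X. f x \<in> U}"
  by (auto simp: clopenin_def intro: openin_continuous_map_preimage closedin_continuous_map_preimage)

lemma zero_dimensional_clopen_nbhd:
  assumes "zero_dimensional X" "openin X U" "x \<in> U"
  shows "\<exists>V. clopenin X V \<and> x \<in> V \<and> V \<subseteq> U"
proof -
  obtain B where B: "\<forall>V\<in>B. openin X V \<and> closedin X V"
    "openin X = arbitrary union_of (\<lambda>V. V \<in> B)"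
    using assms(1) unfolding zero_dimensional_def by blast
  have "(arbitrary union_of (\<lambda>V. V \<in> B)) U"
    using assms(2) B(2) by simp
  then obtain \<U> where "\<U> \<subseteq> B" "\<Union>\<U> = U"
    unfolding union_of_def by auto
  with assms(3) B(1) show ?thesis
    unfolding clopenin_def by blast
qed

text \<open>
  Balls of radius \<open>1 / (n + 1)\<close> around the points of a countable dense set form a countable base.
  The greedy constructions on \<open>X\<close> use this to enumerate a cover by small clopen sets.
\<close>

lemma polish_imp_Lindelof_space:
  assumes "polish_topology X"
  shows "Lindelof_space X"
proof -
  have X: "metrizable_space X" "separable_space X"
    using assms completely_metrizable_imp_metrizable_space by (auto simp: polish_topology_def)
  obtain M d where Md: "Metric_space M d" and XM: "X = Metric_space.mtopology M d"
    using X(1) by (auto simp: metrizable_space_def)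
  interpret Metric_space M d by fact
  obtain C where C: "countable C" "C \<subseteq> M" "mtopology closure_of C = M"
    using X(2) by (auto simp: separable_space_def XM)
  define \<B> where "\<B> = (\<lambda>(c, n). mball c (inverse (real (Suc n)))) ` (C \<times> UNIV)"
  have "countable \<B>"
    using C(1) by (auto simp: \<B>_def)
  moreover have "openin X V" if "V \<in> \<B>" for V
    using that by (auto simp: \<B>_def XM)
  moreover have "\<exists>V\<in>\<B>. x \<in> V \<and> V \<subseteq> U" if U: "openin X U" "x \<in> U" for U x
  proof -
    have xM: "x \<in> M"
      using U openin_subset XM by fastforce
    obtain r where r: "r > 0" "mball x r \<subseteq> U"
      using U by (auto simp: XM openin_mtopology)
    obtain n where n: "inverse (real (Suc n)) < r / 2"
      using reals_Archimedean[of "r / 2"] r(1) by auto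
    have "x \<in> mtopology closure_of C"
      using C(3) xM by simp
    then obtain c where c: "c \<in> C" "c \<in> mball x (inverse (real (Suc n)))"
      unfolding metric_closure_of by (auto dest: spec[of _ "inverse (real (Suc n))"])
    have "mball c (inverse (real (Suc n))) \<subseteq> mball x r"
    proof
      fix y assume "y \<in> mball c (inverse (real (Suc n)))"
      then have y: "y \<in> M" "d c y < inverse (real (Suc n))" by auto
      have "d x y \<le> d x c + d c y"
        using triangle xM y(1) C(2) c(1) by auto
      then show "y \<in> mball x r"
        using y c n xM by auto
    qed
    moreover have "x \<in> mball c (inverse (real (Suc n)))"
      using c xM by (auto simp: commute)
    ultimately show ?thesis
      using c(1) r(2) unfolding \<B>_def
      by (intro bexI[of _ "mball c (inverse (real (Suc n)))"]) auto
  qed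
  ultimately have "second_countable X"
    unfolding second_countable_def by (intro exI[of _ \<B>]) auto
  then show ?thesis
    by (rule second_countable_imp_Lindelof_space)
qed

text \<open>
  The form in which the hypotheses on \<open>X\<close> are used: the action enters through its equations, and
  the topology through small clopen neighbourhoods and countable subcovers.
\<close>

locale free_zero_dimensional_action = group \<Gamma> for \<Gamma> :: "('g, 'm) monoid_scheme" (structure) +
  fixes X :: "'x topology" and act :: "'g \<Rightarrow> 'x \<Rightarrow> 'x" (infixr \<open>\<cdot>\<close> 75)
  assumes infinite_group: "infinite (carrier \<Gamma>)"
    and act_one: "x \<in> topspace X \<Longrightarrow> \<one> \<cdot> x = x"
    and act_mult: "x \<in> topspace X \<Longrightarrow> g \<in> carrier \<Gamma> \<Longrightarrow> h \<in> carrier \<Gamma> \<Longrightarrow>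
                     (g \<otimes> h) \<cdot> x = g \<cdot> h \<cdot> x"
    and act_free: "x \<in> topspace X \<Longrightarrow> g \<in> carrier \<Gamma> \<Longrightarrow> g \<cdot> x = x \<Longrightarrow> g = \<one>"
    and act_continuous: "g \<in> carrier \<Gamma> \<Longrightarrow> continuous_map X X (act g)"
    and zero_dim: "zero_dimensional X"
    and Hausdorff: "Hausdorff_space X"
    and Lindelof: "Lindelof_space X"
    and nonempty: "topspace X \<noteq> {}"
begin

lemma act_closed [simp]: "x \<in> topspace X \<Longrightarrow> g \<in> carrier \<Gamma> \<Longrightarrow> g \<cdot> x \<in> topspace X"
  using act_continuous by (auto simp: continuous_map_def)

lemma act_inv [simp]: "x \<in> topspace X \<Longrightarrow> g \<in> carrier \<Gamma> \<Longrightarrow> inv g \<cdot> g \<cdot> x = x"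
  by (simp flip: act_mult add: act_one)

lemma act_inv' [simp]: "x \<in> topspace X \<Longrightarrow> g \<in> carrier \<Gamma> \<Longrightarrow> g \<cdot> inv g \<cdot> x = x"
  by (simp flip: act_mult add: act_one)

lemma act_eq_iff:
  assumes "x \<in> topspace X" "y \<in> topspace X" "g \<in> carrier \<Gamma>" "h \<in> carrier \<Gamma>"
  shows "g \<cdot> x = h \<cdot> y \<longleftrightarrow> y = (inv h \<otimes> g) \<cdot> x"
proof
  assume "g \<cdot> x = h \<cdot> y"
  then have "inv h \<cdot> g \<cdot> x = inv h \<cdot> h \<cdot> y" by simp
  then show "y = (inv h \<otimes> g) \<cdot> x" using assms by (simp add: act_mult)
qed (use assms in \<open>simp add: act_mult\<close>)

lemma act_inj:
  assumes "x \<in> topspace X" "g \<in> carrier \<Gamma>" "h \<in> carrier \<Gamma>" "g \<cdot> x = h \<cdot> x"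
  shows "g = h"
proof -
  have "x = (inv h \<otimes> g) \<cdot> x"
    using assms act_eq_iff by blast
  then have "inv h \<otimes> g = \<one>"
    using assms(1-3) by (intro act_free[OF assms(1)]) simp_all
  then have "inv g = inv h"
    using assms(2,3) by (intro inv_equality) simp_all
  then show ?thesis
    using assms(2,3) by (metis inv_inv)
qed

definition translates :: "'g set \<Rightarrow> 'x set \<Rightarrow> 'x set" where
  "translates S A = (\<Union>s\<in>S. act s ` A)"

lemma translatesI: "s \<in> S \<Longrightarrow> a \<in> A \<Longrightarrow> s \<cdot> a \<in> translates S A"
  by (auto simp: translates_def)

lemma translatesE:
  assumes "x \<in> translates S A"
  obtains s a where "s \<in> S" "a \<in> A" "x = s \<cdot> a"
  using assms by (auto simp: translates_def)

lemma translates_Un: "translates S (A \<union> B) = translates S A \<union> translates S B"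
  by (auto simp: translates_def)

lemma clopenin_preimage_act:
  "g \<in> carrier \<Gamma> \<Longrightarrow> clopenin X A \<Longrightarrow> clopenin X {x \<in> topspace X. g \<cdot> x \<in> A}"
  using clopenin_preimage[OF act_continuous] by simp

lemma clopenin_image_act:
  assumes "g \<in> carrier \<Gamma>" "clopenin X A"
  shows "clopenin X (act g ` A)"
proof -
  have "act g ` A = {x \<in> topspace X. inv g \<cdot> x \<in> A}"
  proof (intro equalityI subsetI)
    fix x assume "x \<in> {x \<in> topspace X. inv g \<cdot> x \<in> A}"
    then show "x \<in> act g ` A"
      using assms(1) by (intro image_eqI[of _ _ "inv g \<cdot> x"]) auto
  qed (use assms clopenin_subset[OF assms(2)] in auto)
  then show ?thesis
    using clopenin_preimage_act assms by simp
qed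

lemma clopenin_translates:
  "finite S \<Longrightarrow> S \<subseteq> carrier \<Gamma> \<Longrightarrow> clopenin X A \<Longrightarrow> clopenin X (translates S A)"
  unfolding translates_def by (rule clopenin_UN) (auto intro: clopenin_image_act)

lemma clopenin_Collect_bex:
  assumes "finite S" "S \<subseteq> carrier \<Gamma>" "clopenin X A"
  shows "clopenin X {x \<in> topspace X. \<exists>s\<in>S. s \<cdot> x \<in> A}"
proof -
  have "{x \<in> topspace X. \<exists>s\<in>S. s \<cdot> x \<in> A} = (\<Union>s\<in>S. {x \<in> topspace X. s \<cdot> x \<in> A})" by auto
  then show ?thesis
    using assms by (auto intro!: clopenin_UN clopenin_preimage_act)
qed

text \<open>
  By freeness the finitely many points \<open>h \<cdot> x\<close> all differ from \<open>x\<close>, so the Hausdorff property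
  separates them from \<open>x\<close>, uniformly on a clopen neighbourhood by continuity.
\<close>

lemma small_clopen_nbhd:
  assumes "finite H" "H \<subseteq> carrier \<Gamma>" "\<one> \<notin> H" and x: "x \<in> topspace X"
  shows "\<exists>U. clopenin X U \<and> x \<in> U \<and> (\<forall>y\<in>U. \<forall>h\<in>H. h \<cdot> y \<notin> U)"
  using assms(1-3)
proof (induction H rule: finite_induct)
  case empty
  then show ?case using x by (intro exI[of _ "topspace X"]) auto
next
  case (insert h H)
  then obtain U where U: "clopenin X U" "x \<in> U" "\<forall>y\<in>U. \<forall>h\<in>H. h \<cdot> y \<notin> U" by auto
  have h: "h \<in> carrier \<Gamma>" "h \<cdot> x \<noteq> x"
    using insert.prems act_free x by auto
  then obtain P Q where PQ: "openin X P" "openin X Q" "x \<in> P" "h \<cdot> x \<in> Q" "disjnt P Q"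
    using Hausdorff x act_closed[OF x h(1)] unfolding Hausdorff_space_def by metis
  have "openin X (U \<inter> P \<inter> {y \<in> topspace X. h \<cdot> y \<in> Q})"
    using U(1) PQ h act_continuous
    by (intro openin_Int openin_continuous_map_preimage) (auto simp: clopenin_def)
  moreover have "x \<in> U \<inter> P \<inter> {y \<in> topspace X. h \<cdot> y \<in> Q}"
    using U PQ x by auto
  ultimately obtain V where V: "clopenin X V" "x \<in> V" "V \<subseteq> U \<inter> P \<inter> {y \<in> topspace X. h \<cdot> y \<in> Q}"
    using zero_dimensional_clopen_nbhd[OF zero_dim] by blast
  then have "\<forall>y\<in>V. \<forall>k\<in>insert h H. k \<cdot> y \<notin> V"
    using U(3) PQ(5) by (auto simp: disjnt_iff)
  with V(1,2) show ?case by blast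
qed

lemma countable_clopen_cover:
  assumes "finite H" "H \<subseteq> carrier \<Gamma>" "\<one> \<notin> H"
  obtains U :: "nat \<Rightarrow> 'x set"
  where "\<And>i. clopenin X (U i)" "\<And>i y h. y \<in> U i \<Longrightarrow> h \<in> H \<Longrightarrow> h \<cdot> y \<notin> U i"
    "(\<Union>i. U i) = topspace X"
proof -
  define \<U> where "\<U> = {U. clopenin X U \<and> (\<forall>y\<in>U. \<forall>h\<in>H. h \<cdot> y \<notin> U)}"
  have "\<Union>\<U> = topspace X"
    using small_clopen_nbhd[OF assms] clopenin_subset unfolding \<U>_def by fast
  moreover have "\<forall>U\<in>\<U>. openin X U"
    by (auto simp: \<U>_def clopenin_def)
  ultimately obtain \<V> where \<V>: "countable \<V>" "\<V> \<subseteq> \<U>" "\<Union>\<V> = topspace X"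
    using Lindelof unfolding Lindelof_space_def by metis
  then have "\<V> \<noteq> {}"
    using nonempty by (metis Union_empty)
  then have U: "from_nat_into \<V> i \<in> \<V>" "range (from_nat_into \<V>) = \<V>" for i
    using \<V>(1) by (simp_all add: from_nat_into range_from_nat_into)
  show ?thesis
  proof (rule that)
    show "clopenin X (from_nat_into \<V> i)" for i
      using U(1)[of i] \<V>(2) unfolding \<U>_def by blast
    show "h \<cdot> y \<notin> from_nat_into \<V> i" if "y \<in> from_nat_into \<V> i" "h \<in> H" for i y h
      using U(1)[of i] \<V>(2) that unfolding \<U>_def by blast
    show "(\<Union>i. from_nat_into \<V> i) = topspace X"
      using U(2) \<V>(3) by simp
  qed
qed

text \<open>
  A greedy choice along a countable cover by clopen sets that are themselves independent: at each
  stage all points of the current piece that have no neighbour chosen so far are added at once.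
  Each stage is clopen.  The union is open as a union, and its complement is open because
  a point is rejected for good at a finite stage.
\<close>

lemma clopen_maximal_independent_set:
  assumes H: "finite H" "H \<subseteq> carrier \<Gamma>" "\<one> \<notin> H" "\<And>h. h \<in> H \<Longrightarrow> inv h \<in> H"
    and Z: "clopenin X Z"
  obtains M where "clopenin X M" "M \<subseteq> Z" "\<And>x h. x \<in> M \<Longrightarrow> h \<in> H \<Longrightarrow> h \<cdot> x \<notin> M"
    "\<And>x. x \<in> Z \<Longrightarrow> x \<in> M \<or> (\<exists>h\<in>H. h \<cdot> x \<in> M)"
proof -
  obtain U :: "nat \<Rightarrow> 'x set" where U: "\<And>i. clopenin X (U i)"
    "\<And>i y h. y \<in> U i \<Longrightarrow> h \<in> H \<Longrightarrow> h \<cdot> y \<notin> U i" "(\<Union>i. U i) = topspace X"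
    using countable_clopen_cover[OF H(1-3)] by metis
  define N where "N A = {x \<in> topspace X. \<exists>h\<in>H. h \<cdot> x \<in> A}" for A
  define A where "A = rec_nat {} (\<lambda>i B. B \<union> (Z \<inter> U i - N B))"
  have A0: "A 0 = {}" and AS: "A (Suc i) = A i \<union> (Z \<inter> U i - N (A i))" for i
    by (auto simp: A_def)
  have N: "clopenin X (N B)" if "clopenin X B" for B
    unfolding N_def by (rule clopenin_Collect_bex[OF H(1,2) that])
  have A: "clopenin X (A i)" for i
    by (induction i) (auto simp: A0 AS intro!: clopenin_Un clopenin_Int clopenin_Diff N Z U)
  have mono: "A i \<subseteq> A j" if "i \<le> j" for i j
    using that by (rule lift_Suc_mono_le[rotated]) (auto simp: AS)
  have AZ: "A i \<subseteq> Z" for i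
    by (induction i) (auto simp: A0 AS)
  have ind: "\<forall>x\<in>A i. \<forall>h\<in>H. h \<cdot> x \<notin> A i" for i
  proof (induction i)
    case (Suc i)
    show ?case
    proof (intro ballI notI)
      fix x h assume x: "x \<in> A (Suc i)" and h: "h \<in> H" and hx: "h \<cdot> x \<in> A (Suc i)"
      have xX: "x \<in> topspace X"
        using x A clopenin_subset by blast
      have hx': "inv h \<cdot> h \<cdot> x = x" "inv h \<in> H" "h \<cdot> x \<in> topspace X"
        using xX h H by auto
      consider "x \<in> A i" "h \<cdot> x \<in> A i" | "x \<in> A i" "h \<cdot> x \<notin> N (A i)"
        | "x \<notin> N (A i)" "h \<cdot> x \<in> A i" | "x \<in> U i" "h \<cdot> x \<in> U i"
        using x hx unfolding AS by blast
      then show False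
      proof cases
        case 1 then show ?thesis using Suc h by blast
      next
        case 2 then show ?thesis unfolding N_def using hx' by auto
      next
        case 3 then show ?thesis unfolding N_def using xX h by auto
      next
        case 4 then show ?thesis using U(2) h by blast
      qed
    qed
  qed (simp add: A0)
  define M where "M = (\<Union>i. A i)"
  have indM: "h \<cdot> x \<notin> M" if "x \<in> M" "h \<in> H" for x h
  proof
    assume "h \<cdot> x \<in> M"
    with that(1) obtain i j where "x \<in> A i" "h \<cdot> x \<in> A j" by (auto simp: M_def)
    then have "x \<in> A (max i j)" "h \<cdot> x \<in> A (max i j)"
      using mono[of i "max i j"] mono[of j "max i j"] by auto
    then show False using ind that(2) by blast
  qed
  have max: "x \<in> M \<or> (\<exists>i. x \<in> N (A i))" if "x \<in> Z" for x
  proof -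
    obtain i where "x \<in> U i"
      using U(3) clopenin_subset[OF Z] \<open>x \<in> Z\<close> by blast
    then show ?thesis
      using that AS[of i] by (auto simp: M_def)
  qed
  \<comment> \<open>Off \<open>M\<close> a point of \<open>Z\<close> is excluded by some finite stage, which is an open condition.\<close>
  have "topspace X - M = (topspace X - Z) \<union> (\<Union>i. N (A i))"
  proof -
    have "topspace X - M \<subseteq> (topspace X - Z) \<union> (\<Union>i. N (A i))"
    proof
      fix x assume "x \<in> topspace X - M"
      then show "x \<in> (topspace X - Z) \<union> (\<Union>i. N (A i))"
        using max[of x] by (cases "x \<in> Z") auto
    qed
    moreover have "N (A i) \<subseteq> topspace X - M" for i
    proof
      fix x assume "x \<in> N (A i)"
      then show "x \<in> topspace X - M"
        using indM[of x] unfolding N_def M_def by blast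
    qed
    moreover have "M \<subseteq> Z"
      using AZ by (auto simp: M_def)
    ultimately show ?thesis
      by (intro equalityI Un_least UN_least Diff_mono) auto
  qed
  moreover have "openin X ((topspace X - Z) \<union> (\<Union>i. N (A i)))"
    using Z N A by (auto simp: clopenin_def intro!: openin_Un openin_Union)
  moreover have "openin X M"
    unfolding M_def using A by (auto simp: clopenin_def)
  ultimately have "clopenin X M"
    by (simp add: clopenin_def closedin_def openin_subset)
  moreover have "M \<subseteq> Z"
    using AZ by (auto simp: M_def)
  moreover have "x \<in> M \<or> (\<exists>h\<in>H. h \<cdot> x \<in> M)" if "x \<in> Z" for x
    using max[OF that] unfolding N_def M_def by blast
  ultimately show ?thesis
    using that indM by blast
qed

text \<open>
  The bound \<open>card H < card C\<close> is the greedy one.  The colour classes are successive maximal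
  independent subsets of what is left: a point left over at the end would have
  a neighbour of every colour, hence more than \<open>card H\<close> neighbours.
\<close>

lemma clopen_proper_colouring:
  fixes C :: "'c set"
  assumes H: "finite H" "H \<subseteq> carrier \<Gamma>" "\<one> \<notin> H" "\<And>h. h \<in> H \<Longrightarrow> inv h \<in> H"
    and C: "finite C" "card H < card C"
  obtains \<phi> :: "'x \<Rightarrow> 'c"
  where "\<And>x. x \<in> topspace X \<Longrightarrow> \<phi> x \<in> C" "\<And>c. clopenin X {x \<in> topspace X. \<phi> x = c}"
    "\<And>x h. x \<in> topspace X \<Longrightarrow> h \<in> H \<Longrightarrow> \<phi> (h \<cdot> x) \<noteq> \<phi> x"
proof -
  \<comment> \<open>\<open>R\<close> is the set of points not coloured yet; the last conjunct records that each of them has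
     neighbours of all the colours used so far.\<close>
  have step: "\<exists>\<psi> R. clopenin X R \<and> (\<forall>c. clopenin X {x \<in> topspace X. x \<notin> R \<and> \<psi> x = c}) \<and>
      (\<forall>x\<in>topspace X - R. \<psi> x \<in> C') \<and>
      (\<forall>x\<in>topspace X - R. \<forall>h\<in>H. h \<cdot> x \<notin> R \<longrightarrow> \<psi> (h \<cdot> x) \<noteq> \<psi> x) \<and>
      (\<forall>x\<in>R. \<forall>c\<in>C'. \<exists>h\<in>H. h \<cdot> x \<notin> R \<and> \<psi> (h \<cdot> x) = c)"
    if "finite C'" for C' :: "'c set"
    using that
  proof (induction C' rule: finite_induct)
    case empty
    have no_colour: "{x \<in> topspace X. x \<notin> topspace X \<and> \<psi> x = c} = {}" for \<psi> and c :: 'c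
      by auto
    show ?case
      by (rule exI, rule exI[of _ "topspace X"]) (simp add: no_colour)
  next
    case (insert a C')
    then obtain \<psi> R where R: "clopenin X R"
      and 1: "\<And>c. clopenin X {x \<in> topspace X. x \<notin> R \<and> \<psi> x = c}"
      and 2: "\<And>x. x \<in> topspace X - R \<Longrightarrow> \<psi> x \<in> C'"
      and 3: "\<And>x h. x \<in> topspace X - R \<Longrightarrow> h \<in> H \<Longrightarrow> h \<cdot> x \<notin> R \<Longrightarrow> \<psi> (h \<cdot> x) \<noteq> \<psi> x"
      and 4: "\<And>x c. x \<in> R \<Longrightarrow> c \<in> C' \<Longrightarrow> \<exists>h\<in>H. h \<cdot> x \<notin> R \<and> \<psi> (h \<cdot> x) = c"
      by blast
    obtain M where M: "clopenin X M" "M \<subseteq> R" "\<And>x h. x \<in> M \<Longrightarrow> h \<in> H \<Longrightarrow> h \<cdot> x \<notin> M"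
      "\<And>x. x \<in> R \<Longrightarrow> x \<in> M \<or> (\<exists>h\<in>H. h \<cdot> x \<in> M)"
      using clopen_maximal_independent_set[OF H R] by metis
    have RX: "R \<subseteq> topspace X" by (rule clopenin_subset[OF R])
    define \<psi>' where "\<psi>' x = (if x \<in> M then a else \<psi> x)" for x
    have "clopenin X (R - M)"
      using R M by (intro clopenin_Diff)
    moreover have "clopenin X {x \<in> topspace X. x \<notin> R - M \<and> \<psi>' x = c}" for c
    proof -
      have "{x \<in> topspace X. x \<notin> R - M \<and> \<psi>' x = c} =
            {x \<in> topspace X. x \<notin> R \<and> \<psi> x = c} \<union> (if c = a then M else {})"
        using M(2) RX by (auto simp: \<psi>'_def)
      then show ?thesis
        using 1 M(1) by (auto intro: clopenin_Un)
    qed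
    moreover have "\<psi>' x \<in> insert a C'" if "x \<in> topspace X - (R - M)" for x
      using that 2 by (auto simp: \<psi>'_def)
    moreover have "\<psi>' (h \<cdot> x) \<noteq> \<psi>' x"
      if x: "x \<in> topspace X - (R - M)" and h: "h \<in> H" "h \<cdot> x \<notin> R - M" for x h
    proof -
      have hx: "h \<cdot> x \<in> topspace X" using x h H by auto
      have "\<psi> y \<noteq> a" if "y \<in> topspace X" "y \<notin> R" for y
        using 2 that insert.hyps by blast
      then show ?thesis
        using M(2) M(3)[of x h] 3[of x h] x h hx by (auto simp: \<psi>'_def)
    qed
    moreover have "\<exists>h\<in>H. h \<cdot> x \<notin> R - M \<and> \<psi>' (h \<cdot> x) = c"
      if "x \<in> R - M" "c \<in> insert a C'" for x c
    proof (cases "c = a")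
      case True
      then show ?thesis using that M(4)[of x] by (auto simp: \<psi>'_def)
    next
      case False
      then show ?thesis using that 4[of x c] M(2) by (force simp: \<psi>'_def)
    qed
    ultimately show ?case
      by (intro exI[of _ \<psi>'] exI[of _ "R - M"]) blast
  qed
  obtain \<phi> R where R: "clopenin X R"
    and 1: "\<And>c. clopenin X {x \<in> topspace X. x \<notin> R \<and> \<phi> x = c}"
    and 2: "\<And>x. x \<in> topspace X - R \<Longrightarrow> \<phi> x \<in> C"
    and 3: "\<And>x h. x \<in> topspace X - R \<Longrightarrow> h \<in> H \<Longrightarrow> h \<cdot> x \<notin> R \<Longrightarrow> \<phi> (h \<cdot> x) \<noteq> \<phi> x"
    and 4: "\<And>x c. x \<in> R \<Longrightarrow> c \<in> C \<Longrightarrow> \<exists>h\<in>H. h \<cdot> x \<notin> R \<and> \<phi> (h \<cdot> x) = c"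
    using step[OF C(1)] by blast
  have "R = {}"
  proof (rule ccontr)
    assume "R \<noteq> {}"
    then obtain x where "x \<in> R" by auto
    with 4 have "C \<subseteq> (\<lambda>h. \<phi> (h \<cdot> x)) ` H" by (auto simp: image_iff)
    then have "card C \<le> card H"
      using H(1) by (meson card_image_le card_mono finite_imageI order_trans)
    then show False using C(2) by simp
  qed
  then show ?thesis
    using that[of \<phi>] 1 2 3 by auto
qed

end

section \<open>Generic finite subsets of an infinite group and sparse clopen sets of markers\<close>

context group
begin

text \<open>
  \<open>S\<close> supplies the positions of the bits written around a marker.  A translate of \<open>S\<close> should meet
  \<open>S\<close> as little as possible, so that a translated copy of the bits is never mistaken for the
  original.  Two common elements cannot be avoided in general: if \<open>g = inv b \<otimes> c\<close> is an involution, right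
  multiplication by \<open>g\<close> swaps \<open>b\<close> and \<open>c\<close>.  Three can be, by choosing the elements one
  after the other outside a finite set.
\<close>

lemma generic_finite_set:
  assumes "infinite (carrier G)" "finite E" "E \<subseteq> carrier G"
  shows "\<exists>S. S \<subseteq> carrier G \<and> finite S \<and> card S = n \<and>
           (\<forall>s\<in>S. \<forall>t\<in>S. \<forall>e\<in>E. t = e \<otimes> s \<longrightarrow> t = s) \<and>
           (\<forall>g\<in>carrier G. g \<noteq> \<one> \<longrightarrow> card {b \<in> S. b \<otimes> g \<in> S} \<le> 2)"
proof (induction n)
  case 0
  show ?case by (intro exI[of _ "{}"]) auto
next
  case (Suc n)
  then obtain S where S: "S \<subseteq> carrier G" "finite S" "card S = n"
    and sep: "\<And>s t e. s \<in> S \<Longrightarrow> t \<in> S \<Longrightarrow> e \<in> E \<Longrightarrow> t = e \<otimes> s \<Longrightarrow> t = s"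
    and gen: "\<And>g. g \<in> carrier G \<Longrightarrow> g \<noteq> \<one> \<Longrightarrow> card {b \<in> S. b \<otimes> g \<in> S} \<le> 2"
    by blast
  define P where "P = S \<union> (\<lambda>(a, b, c). a \<otimes> inv b \<otimes> c) ` (S \<times> S \<times> S)
      \<union> (\<lambda>(e, s). e \<otimes> s) ` (E \<times> S) \<union> (\<lambda>(e, s). inv e \<otimes> s) ` (E \<times> S)"
  have "finite P"
    using S(2) assms(2) by (simp add: P_def)
  then obtain x where x: "x \<in> carrier G" "x \<notin> P"
    using assms(1) by (meson finite_subset subsetI)
  have xS: "x \<notin> S"
    using x(2) by (auto simp: P_def)
  have xT: "x \<noteq> a \<otimes> inv b \<otimes> c" if "a \<in> S" "b \<in> S" "c \<in> S" for a b c
    using x(2) that by (force simp: P_def)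
  have xE: "x \<noteq> e \<otimes> s" "x \<noteq> inv e \<otimes> s" if "e \<in> E" "s \<in> S" for e s
    using x(2) that by (force simp: P_def)+
  have "t = s" if "s \<in> insert x S" "t \<in> insert x S" "e \<in> E" "t = e \<otimes> s" for s t e
  proof (cases "s \<in> S")
    case True
    then show ?thesis using that xE sep by blast
  next
    case False
    then have s: "s = x" using that(1) by simp
    have e: "e \<in> carrier G" using that(3) assms(3) by blast
    have "x = inv e \<otimes> t"
      using that(4) s e x(1) by (simp add: m_assoc[symmetric])
    then have "t \<notin> S" using xE(2) that(3) by blast
    then show ?thesis using that(2) s by simp
  qed
  moreover have "card {b \<in> insert x S. b \<otimes> g \<in> insert x S} \<le> 2" if g: "g \<in> carrier G" "g \<noteq> \<one>" for g
  proof (cases "{b \<in> S. b \<otimes> g \<in> S} = {}")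
    case True
    have "{b \<in> insert x S. b \<otimes> g \<in> insert x S} \<subseteq> {x, x \<otimes> inv g}"
    proof
      fix b assume b: "b \<in> {b \<in> insert x S. b \<otimes> g \<in> insert x S}"
      have bc: "b \<in> carrier G" using b x S by blast
      show "b \<in> {x, x \<otimes> inv g}"
      proof (cases "b = x")
        case False
        then have "b \<otimes> g = x" using b True by blast
        then have "b = x \<otimes> inv g" using bc g by (auto simp: m_assoc)
        then show ?thesis by simp
      qed simp
    qed
    then have "card {b \<in> insert x S. b \<otimes> g \<in> insert x S} \<le> card {x, x \<otimes> inv g}"
      by (rule card_mono[rotated]) simp
    also have "\<dots> \<le> 2" by (simp add: card_insert_if)
    finally show ?thesis .
  next
    \<comment> \<open>A coincidence inside \<open>S\<close> determines \<open>g\<close>, and one more coincidence involving the new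
       point would put it in \<open>S S\<inverse> S\<close>.\<close>
    case False
    then obtain b where b: "b \<in> S" "b \<otimes> g \<in> S" by blast
    have bc: "b \<in> carrier G" "b \<otimes> g \<in> carrier G" using b S by blast+
    have gb: "g = inv b \<otimes> (b \<otimes> g)" using bc g by (simp add: m_assoc[symmetric])
    have "{b \<in> insert x S. b \<otimes> g \<in> insert x S} \<subseteq> {b \<in> S. b \<otimes> g \<in> S}"
    proof
      fix c assume c: "c \<in> {b \<in> insert x S. b \<otimes> g \<in> insert x S}"
      have cc: "c \<in> carrier G" using c x S by blast
      have "c \<noteq> x"
      proof
        assume "c = x"
        then have "x \<otimes> g \<in> S" using c g x(1) by auto
        moreover have "(x \<otimes> g) \<otimes> inv (b \<otimes> g) \<otimes> b = x \<otimes> (g \<otimes> inv g) \<otimes> (inv b \<otimes> b)"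
          using x(1) g(1) bc by (simp only: inv_mult_group m_assoc m_closed inv_closed)
        then have "x = (x \<otimes> g) \<otimes> inv (b \<otimes> g) \<otimes> b"
          using x(1) g(1) bc(1) by simp
        ultimately show False using xT b by blast
      qed
      moreover have "c \<otimes> g \<noteq> x"
      proof
        assume "c \<otimes> g = x"
        moreover have "c \<otimes> inv b \<otimes> (b \<otimes> g) = c \<otimes> (inv b \<otimes> (b \<otimes> g))"
          using cc bc by (simp only: m_assoc inv_closed)
        ultimately have "x = c \<otimes> inv b \<otimes> (b \<otimes> g)"
          using gb by simp
        then show False using xT b c \<open>c \<noteq> x\<close> by blast
      qed
      ultimately show "c \<in> {b \<in> S. b \<otimes> g \<in> S}" using c by blast
    qed
    then have "card {b \<in> insert x S. b \<otimes> g \<in> insert x S} \<le> card {b \<in> S. b \<otimes> g \<in> S}"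
      by (rule card_mono[rotated]) (simp add: S)
    then show ?thesis using gen[OF g] by simp
  qed
  moreover have "insert x S \<subseteq> carrier G" "finite (insert x S)" "card (insert x S) = Suc n"
    using S x xS by auto
  ultimately show ?case
    by (intro exI[of _ "insert x S"]) blast
qed

lemma finite_symmetric_superset:
  assumes "finite F" "F \<subseteq> carrier G"
  obtains E where "finite E" "E \<subseteq> carrier G" "F \<subseteq> E" "\<one> \<in> E" "\<And>e. e \<in> E \<Longrightarrow> inv e \<in> E"
proof (rule that)
  let ?E = "F \<union> m_inv G ` F \<union> {\<one>}"
  show "inv e \<in> ?E" if "e \<in> ?E" for e
    using that assms(2) by (auto simp: subset_iff)
qed (use assms in auto)

end

text \<open>
  This is what lets \<open>r\<close> bits around each marker name enough colours: the number of colours required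
  grows only polynomially in the number of positions, which is \<open>r + 4\<close>.
\<close>

lemma exponential_beats_quintic:
  fixes a :: nat
  shows "\<exists>r. a * (r + 4) ^ 5 < 2 ^ r"
proof -
  have "(\<lambda>r. real (r + 4) ^ 5 / 2 ^ r) \<longlonglongrightarrow> 0"
    by real_asymp
  then have "\<forall>\<^sub>F r in sequentially. real (r + 4) ^ 5 / 2 ^ r < 1 / (real a + 1)"
    by (rule order_tendstoD) simp
  then obtain r where "real (r + 4) ^ 5 / 2 ^ r < 1 / (real a + 1)"
    by (auto simp: eventually_sequentially)
  then have "real (r + 4) ^ 5 * (real a + 1) < 2 ^ r"
    by (simp add: field_simps)
  then have "real (a * (r + 4) ^ 5) < real (2 ^ r)"
    by (simp add: algebra_simps) (smt (verit) zero_le_power of_nat_0_le_iff)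
  then show ?thesis
    by (metis of_nat_less_iff)
qed

context free_zero_dimensional_action
begin

definition separated :: "'g set \<Rightarrow> 'x set \<Rightarrow> bool" where
  "separated E A \<longleftrightarrow> (\<forall>x\<in>A. \<forall>e\<in>E. e \<cdot> x \<in> A \<longrightarrow> e \<cdot> x = x)"

lemma separatedD: "separated E A \<Longrightarrow> x \<in> A \<Longrightarrow> e \<in> E \<Longrightarrow> e \<cdot> x \<in> A \<Longrightarrow> e \<cdot> x = x"
  by (auto simp: separated_def)

lemma separated_mono: "separated E A \<Longrightarrow> F \<subseteq> E \<Longrightarrow> separated F A"
  by (auto simp: separated_def)

text \<open>
  \<open>M\<close> is a maximal \<open>H\<close>-independent subset of the clopen set of points allowed by \<open>Q\<close>.  The point
  is that the return set in the last conclusion depends only on \<open>H\<close> and \<open>K\<close>, and not on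
  \<open>Q\<close>: if \<open>Q\<close> is sparse enough, every window \<open>K x\<close> contains an allowed point.
\<close>

lemma clopen_markers:
  assumes H: "finite H" "H \<subseteq> carrier \<Gamma>" "\<And>h. h \<in> H \<Longrightarrow> inv h \<in> H"
    and L: "finite L" "L \<subseteq> carrier \<Gamma>"
    and K: "finite K" "K \<subseteq> carrier \<Gamma>" "card L < card K"
    and E: "\<And>g h k l. g \<in> L \<Longrightarrow> h \<in> L \<Longrightarrow> k \<in> K \<Longrightarrow> l \<in> K \<Longrightarrow> h \<otimes> l \<otimes> inv (g \<otimes> k) \<in> E"
    and Q: "clopenin X Q" "separated E Q"
  obtains M where "clopenin X M" "separated H M" "\<And>y g. y \<in> M \<Longrightarrow> g \<in> L \<Longrightarrow> g \<cdot> y \<notin> Q"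
    "\<And>x. x \<in> topspace X \<Longrightarrow> \<exists>h\<in>insert \<one> H. \<exists>k\<in>K. h \<cdot> k \<cdot> x \<in> M"
proof -
  define Z where "Z = topspace X - {y \<in> topspace X. \<exists>g\<in>L. g \<cdot> y \<in> Q}"
  have Z: "clopenin X Z"
    unfolding Z_def by (intro clopenin_Diff clopenin_Collect_bex clopenin_topspace L Q)
  have "finite (H - {\<one>})" "H - {\<one>} \<subseteq> carrier \<Gamma>" "\<one> \<notin> H - {\<one>}"
    using H by auto
  moreover have "inv h \<in> H - {\<one>}" if "h \<in> H - {\<one>}" for h
    using H that by (auto simp: subset_iff inv_eq_1_iff)
  ultimately obtain M where M: "clopenin X M" "M \<subseteq> Z"
    "\<And>x h. x \<in> M \<Longrightarrow> h \<in> H - {\<one>} \<Longrightarrow> h \<cdot> x \<notin> M"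
    "\<And>x. x \<in> Z \<Longrightarrow> x \<in> M \<or> (\<exists>h\<in>H - {\<one>}. h \<cdot> x \<in> M)"
    using clopen_maximal_independent_set[OF _ _ _ _ Z, of "H - {\<one>}"] by metis
  have MX: "M \<subseteq> topspace X"
    by (rule clopenin_subset[OF M(1)])
  have "separated H M"
    unfolding separated_def
  proof (intro ballI impI)
    fix x h assume x: "x \<in> M" and h: "h \<in> H" "h \<cdot> x \<in> M"
    then have "h = \<one>" using M(3) by blast
    then show "h \<cdot> x = x" using act_one x MX by blast
  qed
  moreover have "g \<cdot> y \<notin> Q" if "y \<in> M" "g \<in> L" for y g
    using that M(2) by (auto simp: Z_def)
  moreover have "\<exists>h\<in>insert \<one> H. \<exists>k\<in>K. h \<cdot> k \<cdot> x \<in> M" if x: "x \<in> topspace X" for x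
  proof -
    have kX: "k \<cdot> x \<in> topspace X" if "k \<in> K" for k
      using that x K(2) by auto
    \<comment> \<open>Pigeonhole: the excluded points of the window \<open>K x\<close> are all excluded by the same point of
       \<open>Q\<close>, which excludes at most \<open>card L\<close> of them.\<close>
    have "\<exists>k\<in>K. k \<cdot> x \<in> Z"
    proof (rule ccontr)
      assume "\<not> (\<exists>k\<in>K. k \<cdot> x \<in> Z)"
      then have "\<forall>k\<in>K. \<exists>g\<in>L. g \<cdot> k \<cdot> x \<in> Q"
        using kX by (auto simp: Z_def)
      then obtain f where f: "\<And>k. k \<in> K \<Longrightarrow> f k \<in> L" "\<And>k. k \<in> K \<Longrightarrow> f k \<cdot> k \<cdot> x \<in> Q"
        by metis
      have "inj_on f K"
      proof (rule inj_onI)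
        fix k l assume k: "k \<in> K" and l: "l \<in> K" and eq: "f k = f l"
        have c: "k \<in> carrier \<Gamma>" "l \<in> carrier \<Gamma>" "f k \<in> carrier \<Gamma>" "f l \<in> carrier \<Gamma>"
          using k l K(2) L(2) f(1) by blast+
        have "f l \<cdot> l \<cdot> x = (f l \<otimes> l \<otimes> inv (f k \<otimes> k)) \<cdot> (f k \<otimes> k) \<cdot> x"
          using c x by (simp add: m_assoc flip: act_mult)
        moreover have "f l \<otimes> l \<otimes> inv (f k \<otimes> k) \<in> E"
          using E f(1) k l by blast
        ultimately have "f l \<cdot> l \<cdot> x = f k \<cdot> k \<cdot> x"
          using separatedD[OF Q(2) f(2)[OF k], of "f l \<otimes> l \<otimes> inv (f k \<otimes> k)"] f(2)[OF l] c x
          by (simp add: act_mult)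
        then have "(f l \<otimes> l) \<cdot> x = (f k \<otimes> k) \<cdot> x"
          using c x by (simp add: act_mult)
        then have "f l \<otimes> l = f k \<otimes> k"
          using act_inj[OF x] c by blast
        then show "k = l" using eq c by simp
      qed
      then have "card K \<le> card L"
        using f(1) L(1) by (intro card_inj_on_le[of f]) auto
      then show False using K(3) by simp
    qed
    then obtain k where k: "k \<in> K" "k \<cdot> x \<in> Z" by blast
    then show ?thesis
      using M(4)[OF k(2)] act_one[OF kX[OF k(1)]] by (metis DiffD1 insertCI)
  qed
  ultimately show ?thesis
    using that M(1) by blast
qed

end

section \<open>One level of markers\<close>

context free_zero_dimensional_action
begin

text \<open>
  The interface of one level of the construction, whose task is to distinguish \<open>x\<close> from \<open>\<gamma> \<cdot> x\<close>.
  Here \<open>Q\<close> is the sparse set of positions used by the higher, sparser levels, \<open>translates D Q\<close> is where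
  those levels may write, \<open>M\<close> is the new set of markers, \<open>translates S M\<close> the new set of
  positions, and \<open>Z\<close> the set of positions carrying the bit 1.  The clauses say that the new
  positions keep away from those of the higher levels, that the markers can be read off from the 1s (all
  positions \<open>B\<close> around a point carry 1 exactly when the point is a marker, no matter what the
  higher levels write), and that a window \<open>K\<close>
  around any \<open>x\<close> finds a marker \<open>w \<cdot> x\<close> whose bits differ from those at
  \<open>w \<cdot> \<gamma> \<cdot> x\<close>, should that be a marker as well.
\<close>

definition marker_level ::
    "'g set \<Rightarrow> 'g set \<Rightarrow> 'g \<Rightarrow> 'g set \<Rightarrow> 'g set \<Rightarrow> 'g set \<Rightarrow> 'x set \<Rightarrow> 'x set \<Rightarrow> 'x set \<Rightarrow> bool" where
  "marker_level D E \<gamma> S B K Q M Z \<longleftrightarrow>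
     clopenin X M \<and> clopenin X Z \<and> Z \<subseteq> translates S M \<and>
     separated E (Q \<union> translates S M) \<and>
     translates D Q \<inter> translates S M = {} \<and>
     translates B M \<subseteq> Z \<and>
     (\<forall>z\<in>topspace X. (\<forall>b\<in>B. b \<cdot> z \<in> Z \<union> translates D Q) \<longrightarrow> z \<in> M) \<and>
     (\<forall>x\<in>topspace X. \<exists>w\<in>K. w \<cdot> x \<in> M \<and>
        (w \<cdot> \<gamma> \<cdot> x \<in> M \<longrightarrow> (\<exists>t\<in>S. (t \<cdot> w \<cdot> x \<in> Z) \<noteq> (t \<cdot> w \<cdot> \<gamma> \<cdot> x \<in> Z))))"

text \<open>
  Suppose that all four points \<open>b \<cdot> z\<close> are places where a 1 may stand.  The higher levels are so sparse, and \<open>B\<close> so spread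
  out, that they account for at most one of the four.  At least three belong to one single marker
  \<open>y\<close>, since markers are far apart; so a translate of \<open>S\<close> has three points in common with \<open>S\<close>,
  which genericity permits only for the trivial translation, that is \<open>z = y\<close>.
\<close>

lemma marker_recognition:
  assumes S: "S \<subseteq> carrier \<Gamma>" "finite S"
    and gen: "\<And>g. g \<in> carrier \<Gamma> \<Longrightarrow> g \<noteq> \<one> \<Longrightarrow> card {b \<in> S. b \<otimes> g \<in> S} \<le> 2"
    and sep: "\<And>s t d d'. s \<in> S \<Longrightarrow> t \<in> S \<Longrightarrow> d \<in> D \<Longrightarrow> d' \<in> D \<Longrightarrow> t = d \<otimes> inv d' \<otimes> s \<Longrightarrow> t = s"
    and D: "D \<subseteq> carrier \<Gamma>"
    and B: "B \<subseteq> S" "card B = 4"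
    and M: "M \<subseteq> topspace X" "separated H M"
    and H: "\<And>a b c d. a \<in> S \<Longrightarrow> b \<in> S \<Longrightarrow> c \<in> S \<Longrightarrow> d \<in> S \<Longrightarrow> inv a \<otimes> b \<otimes> inv c \<otimes> d \<in> H"
    and Q: "Q \<subseteq> topspace X" "separated E Q"
    and E: "\<And>d d' b b'. d \<in> D \<Longrightarrow> d' \<in> D \<Longrightarrow> b \<in> B \<Longrightarrow> b' \<in> B \<Longrightarrow> inv d' \<otimes> b' \<otimes> inv b \<otimes> d \<in> E"
    and z: "z \<in> topspace X" "\<And>b. b \<in> B \<Longrightarrow> b \<cdot> z \<in> translates S M \<union> translates D Q"
  shows "z \<in> M"
proof -
  have finB: "finite B" using B S(2) finite_subset by blast
  have Bc: "b \<in> carrier \<Gamma>" if "b \<in> B" for b using that B S by blast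
  define B1 where "B1 = {b \<in> B. b \<cdot> z \<in> translates D Q}"
  have "b = b'" if b: "b \<in> B1" and b': "b' \<in> B1" for b b'
  proof -
    obtain d p where d: "d \<in> D" "p \<in> Q" "b \<cdot> z = d \<cdot> p"
      using b by (auto simp: B1_def elim: translatesE)
    obtain d' p' where d': "d' \<in> D" "p' \<in> Q" "b' \<cdot> z = d' \<cdot> p'"
      using b' by (auto simp: B1_def elim: translatesE)
    have c: "b \<in> carrier \<Gamma>" "b' \<in> carrier \<Gamma>" "d \<in> carrier \<Gamma>" "d' \<in> carrier \<Gamma>" "p \<in> topspace X" "p' \<in> topspace X"
      using b b' d d' D Q(1) Bc by (auto simp: B1_def)
    have z_eq: "z = inv b \<cdot> d \<cdot> p"
      using d(3) c z(1) by (metis act_inv)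
    have "p' = inv d' \<cdot> b' \<cdot> z"
      using d'(3) c by simp
    then have "p' = (inv d' \<otimes> b' \<otimes> inv b \<otimes> d) \<cdot> p"
      using z_eq c by (simp add: act_mult)
    moreover have "inv d' \<otimes> b' \<otimes> inv b \<otimes> d \<in> E"
      using E b b' d d' by (auto simp: B1_def)
    ultimately have "p' = p"
      using separatedD[OF Q(2)] d(2) d'(2) by metis
    then have "b' \<cdot> z = d' \<cdot> inv d \<cdot> b \<cdot> z"
      using d(3) d'(3) c by simp
    then have "b' \<cdot> z = (d' \<otimes> inv d \<otimes> b) \<cdot> z"
      using c z(1) by (simp add: act_mult)
    then have "b' = d' \<otimes> inv d \<otimes> b"
      using c z(1) by (intro act_inj[OF z(1)]) simp_all
    moreover have "b \<in> S" "b' \<in> S"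
      using b b' B(1) by (auto simp: B1_def)
    ultimately show ?thesis
      using sep[OF _ _ d'(1) d(1)] by metis
  qed
  then have "card B1 \<le> 1"
    using finB by (simp add: B1_def card_le_Suc0_iff_eq)
  moreover have "card (B - B1) = card B - card B1"
    using finB by (intro card_Diff_subset) (auto simp: B1_def)
  ultimately have card3: "card (B - B1) \<ge> 3"
    using B(2) by simp
  then obtain b0 where b0: "b0 \<in> B - B1"
    by (metis card.empty equals0I not_numeral_le_zero)
  have marker: "\<exists>s\<in>S. \<exists>y\<in>M. b \<cdot> z = s \<cdot> y" if "b \<in> B - B1" for b
    using z(2)[of b] that by (auto simp: B1_def elim!: translatesE)
  obtain s0 y0 where y0: "s0 \<in> S" "y0 \<in> M" "b0 \<cdot> z = s0 \<cdot> y0"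
    using marker[OF b0] by blast
  have c0: "b0 \<in> carrier \<Gamma>" "s0 \<in> carrier \<Gamma>" "y0 \<in> topspace X"
    using b0 y0 Bc S M(1) by auto
  define g where "g = inv b0 \<otimes> s0"
  have g: "g \<in> carrier \<Gamma>" using c0 by (simp add: g_def)
  have zg: "z = g \<cdot> y0"
    using act_eq_iff[OF c0(3) z(1) c0(2) c0(1)] y0(3) by (simp add: g_def)
  have "b \<otimes> g \<in> S" if b: "b \<in> B - B1" for b
  proof -
    obtain s y where y: "s \<in> S" "y \<in> M" "b \<cdot> z = s \<cdot> y"
      using marker[OF b] by blast
    have c: "b \<in> carrier \<Gamma>" "s \<in> carrier \<Gamma>" "y \<in> topspace X"
      using b y Bc S M(1) by auto
    have "y = inv s \<cdot> b \<cdot> z"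
      using y(3) c by simp
    then have "y = (inv s \<otimes> b \<otimes> inv b0 \<otimes> s0) \<cdot> y0"
      using c c0 by (simp add: zg g_def act_mult)
    moreover have "inv s \<otimes> b \<otimes> inv b0 \<otimes> s0 \<in> H"
      using H b b0 y y0 B by blast
    ultimately have "y = y0"
      using separatedD[OF M(2)] y(2) y0(2) by metis
    then have "(b \<otimes> g) \<cdot> y0 = s \<cdot> y0"
      using y(3) zg c c0 g by (simp add: act_mult)
    then have "b \<otimes> g = s"
      using c g by (intro act_inj[OF c0(3)]) simp_all
    then show ?thesis using y(1) by simp
  qed
  then have "B - B1 \<subseteq> {b \<in> S. b \<otimes> g \<in> S}"
    using B(1) by blast
  then have "card (B - B1) \<le> card {b \<in> S. b \<otimes> g \<in> S}"
    by (rule card_mono[rotated]) (simp add: S)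
  then have "g = \<one>"
    using card3 gen[OF g] by force
  then show ?thesis
    using zg act_one c0 y0(2) by simp
qed

text \<open>
  The constants are chosen before \<open>Q\<close> is known: positions \<open>S\<close>, made of four recognition positions
  \<open>B\<close> and \<open>r\<close> free positions, then a window \<open>K\<close> that must contain a marker, then the sparsity \<open>E'\<close>
  demanded of \<open>Q\<close>.  The free positions around a marker \<open>y\<close> spell out the colour of \<open>y\<close> in a
  colouring that separates \<open>y\<close> from its conjugate translates \<open>(w \<otimes> \<gamma> \<otimes> inv w) \<cdot> y\<close> for \<open>w \<in> K\<close>.  Since
  \<open>w \<cdot> \<gamma> \<cdot> x\<close> is such a translate of \<open>w \<cdot> x\<close>, the two carry different colours if both are markers.

  The number of colours depends on \<open>card K\<close> and thus on \<open>card S = r + 4\<close>.  This is not circular, as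
  \<open>r\<close> bits give \<open>2 ^ r\<close> colours whereas \<open>card K\<close> is polynomial in \<open>r\<close>.
\<close>

lemma marker_level_exists:
  assumes D: "finite D" "D \<subseteq> carrier \<Gamma>"
    and E: "finite E" "E \<subseteq> carrier \<Gamma>"
    and \<gamma>: "\<gamma> \<in> carrier \<Gamma>" "\<gamma> \<noteq> \<one>"
  obtains S B K E'
  where "finite S" "S \<subseteq> carrier \<Gamma>" "B \<subseteq> S" "finite K" "K \<subseteq> carrier \<Gamma>" "finite E'" "E' \<subseteq> carrier \<Gamma>"
    "\<And>Q. clopenin X Q \<Longrightarrow> separated E' Q \<Longrightarrow> \<exists>M Z. marker_level D E \<gamma> S B K Q M Z"
proof -
  define F where "F = E \<union> D \<union> (\<lambda>(d, d'). d \<otimes> inv d') ` (D \<times> D)"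
  have "finite F" "F \<subseteq> carrier \<Gamma>"
    using D E by (auto simp: F_def)
  then obtain E0 where E0: "finite E0" "E0 \<subseteq> carrier \<Gamma>" "F \<subseteq> E0" "\<one> \<in> E0"
    "\<And>e. e \<in> E0 \<Longrightarrow> inv e \<in> E0"
    using finite_symmetric_superset by blast
  have DE0: "d \<in> E0" "d \<otimes> inv d' \<in> E0" if "d \<in> D" "d' \<in> D" for d d'
    using that E0(3) by (auto simp: F_def)
  define e where "e = card E0"
  have e: "e \<ge> 1"
    using E0(1,4) by (auto simp: e_def Suc_le_eq card_gt_0_iff)
  obtain r where r: "12 * e^2 * (r + 4) ^ 5 < 2 ^ r"
    using exponential_beats_quintic by blast
  define s where "s = r + 4"
  obtain S where S: "S \<subseteq> carrier \<Gamma>" "finite S" "card S = s"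
    and sep: "\<And>s t e. s \<in> S \<Longrightarrow> t \<in> S \<Longrightarrow> e \<in> E0 \<Longrightarrow> t = e \<otimes> s \<Longrightarrow> t = s"
    and gen: "\<And>g. g \<in> carrier \<Gamma> \<Longrightarrow> g \<noteq> \<one> \<Longrightarrow> card {b \<in> S. b \<otimes> g \<in> S} \<le> 2"
    using generic_finite_set[OF infinite_group E0(1,2), of s] by blast
  obtain B where B: "B \<subseteq> S" "card B = 4"
    using obtain_subset_with_card_n[of 4 S] S(3) by (auto simp: s_def)
  have Sc: "t \<in> carrier \<Gamma>" if "t \<in> S" for t using that S by blast
  have E0c: "t \<in> carrier \<Gamma>" if "t \<in> E0" for t using that E0 by blast
  \<comment> \<open>\<open>H1\<close>-independence keeps the positions of different markers \<open>E0\<close>-apart, and \<open>H2\<close>-independence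
     ensures that points recognised together stem from the same marker.\<close>
  define H1 where "H1 = (\<lambda>(s, e, t). inv s \<otimes> e \<otimes> t) ` (S \<times> E0 \<times> S)"
  define H2 where "H2 = (\<lambda>(a, b, c, d). inv a \<otimes> b \<otimes> inv c \<otimes> d) ` (S \<times> S \<times> S \<times> S)"
  define H where "H = H1 \<union> H2"
  have H1I: "inv s \<otimes> e \<otimes> t \<in> H" if "s \<in> S" "e \<in> E0" "t \<in> S" for s e t
    unfolding H_def H1_def by (rule UnI1, rule image_eqI[of _ _ "(s, e, t)"]) (use that in auto)
  have H2I: "inv a \<otimes> b \<otimes> inv c \<otimes> d \<in> H" if "a \<in> S" "b \<in> S" "c \<in> S" "d \<in> S" for a b c d
    unfolding H_def H2_def by (rule UnI2, rule image_eqI[of _ _ "(a, b, c, d)"]) (use that in auto)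
  have H: "finite H" "H \<subseteq> carrier \<Gamma>"
    using S E0 by (auto simp: H_def H1_def H2_def subset_iff)
  have Hinv: "inv h \<in> H" if "h \<in> H" for h
  proof -
    consider s e t where "h = inv s \<otimes> e \<otimes> t" "s \<in> S" "e \<in> E0" "t \<in> S"
      | a b c d where "h = inv a \<otimes> b \<otimes> inv c \<otimes> d" "a \<in> S" "b \<in> S" "c \<in> S" "d \<in> S"
      using \<open>h \<in> H\<close> by (auto simp: H_def H1_def H2_def)
    then show ?thesis
    proof cases
      case (1 s e t)
      then have "inv h = inv t \<otimes> inv e \<otimes> s"
        by (simp add: inv_mult_group m_assoc Sc E0c)
      then show ?thesis using H1I E0(5) 1 by simp
    next
      case (2 a b c d)
      then have "inv h = inv d \<otimes> c \<otimes> inv b \<otimes> a"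
        by (simp add: inv_mult_group m_assoc Sc)
      then show ?thesis using H2I 2 by simp
    qed
  qed
  \<comment> \<open>\<open>L\<close> describes the candidates excluded by one point of \<open>Q\<close>; a window of more than \<open>card L\<close>
     points contains a candidate that is not excluded.\<close>
  define L where "L = (\<lambda>(e, s). e \<otimes> s) ` (E0 \<times> S)"
  have L: "finite L" "L \<subseteq> carrier \<Gamma>"
    using S E0 by (auto simp: L_def)
  have LI: "e \<otimes> s \<in> L" if "e \<in> E0" "s \<in> S" for e s
    unfolding L_def by (rule image_eqI[of _ _ "(e, s)"]) (use that in auto)
  obtain K0 where K0: "K0 \<subseteq> carrier \<Gamma>" "finite K0" "card K0 = e * s + 1"
    using infinite_arbitrarily_large[OF infinite_group] by blast
  have card_L: "card L \<le> e * s"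
    unfolding L_def e_def S(3)[symmetric]
    by (metis E0(1) S(2) card_cartesian_product card_image_le finite_cartesian_product)
  define K where "K = (\<lambda>(h, k). h \<otimes> k) ` (insert \<one> H \<times> K0)"
  have K: "finite K" "K \<subseteq> carrier \<Gamma>"
    using H K0 by (auto simp: K_def)
  define E' where "E' = E0 \<union> (\<lambda>(g, h, k, l). h \<otimes> l \<otimes> inv (g \<otimes> k)) ` (L \<times> L \<times> K0 \<times> K0)
      \<union> (\<lambda>(d, d', b, b'). inv d' \<otimes> b' \<otimes> inv b \<otimes> d) ` (D \<times> D \<times> B \<times> B)"
  have E': "finite E'" "E' \<subseteq> carrier \<Gamma>"
    using E0 L K0 D S(1,2) B(1) finite_subset[OF B(1) S(2)] by (auto simp: E'_def subset_iff)
  have E'1: "h \<otimes> l \<otimes> inv (g \<otimes> k) \<in> E'" if "g \<in> L" "h \<in> L" "k \<in> K0" "l \<in> K0" for g h k l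
    unfolding E'_def by (rule UnI1, rule UnI2, rule image_eqI[of _ _ "(g, h, k, l)"]) (use that in auto)
  have E'2: "inv d' \<otimes> b' \<otimes> inv b \<otimes> d \<in> E'" if "d \<in> D" "d' \<in> D" "b \<in> B" "b' \<in> B" for d d' b b'
    unfolding E'_def by (rule UnI2, rule image_eqI[of _ _ "(d, d', b, b')"]) (use that in auto)
  \<comment> \<open>The colouring has to separate points related by \<open>C\<close>; its colours are the subsets of the
     \<open>r\<close> free positions.\<close>
  define C where "C = (\<lambda>w. w \<otimes> \<gamma> \<otimes> inv w) ` K \<union> (\<lambda>w. w \<otimes> inv \<gamma> \<otimes> inv w) ` K"
  have Kc: "w \<in> carrier \<Gamma>" if "w \<in> K" for w using that K by blast
  have C: "finite C" "C \<subseteq> carrier \<Gamma>"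
    using K \<gamma> by (auto simp: C_def)
  have conj_ne: "w \<otimes> g \<otimes> inv w \<noteq> \<one>" if "w \<in> K" "g \<in> carrier \<Gamma>" "g \<noteq> \<one>" for w g
  proof
    assume "w \<otimes> g \<otimes> inv w = \<one>"
    then have "w \<otimes> g = w"
      using that Kc inv_equality[of "w \<otimes> g" "inv w"] by simp
    then show False using that Kc by simp
  qed
  have "\<one> \<noteq> w \<otimes> \<gamma> \<otimes> inv w" "\<one> \<noteq> w \<otimes> inv \<gamma> \<otimes> inv w" if "w \<in> K" for w
    using conj_ne[OF that \<gamma>] conj_ne[OF that, of "inv \<gamma>"] inv_eq_1_iff[OF \<gamma>(1)] \<gamma>
    by (metis inv_closed)+
  then have C1: "\<one> \<notin> C"
    unfolding C_def by blast
  have Cinv: "inv c \<in> C" if "c \<in> C" for c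
  proof -
    have "inv (w \<otimes> g \<otimes> inv w) = w \<otimes> inv g \<otimes> inv w" if "w \<in> K" "g \<in> carrier \<Gamma>" for w g
      using that Kc by (simp add: inv_mult_group m_assoc)
    then show ?thesis using that \<gamma> by (auto simp: C_def)
  qed
  have card_C: "card C < card (Pow (S - B))"
  proof -
    have s1: "s \<ge> 1" by (simp add: s_def)
    have "card H1 \<le> card (S \<times> E0 \<times> S)" "card H2 \<le> card (S \<times> S \<times> S \<times> S)"
      unfolding H1_def H2_def by (intro card_image_le finite_cartesian_product S(2) E0(1))+
    then have "card H \<le> s^2 * e + s^4"
      using card_Un_le[of H1 H2]
      by (simp add: card_cartesian_product S(3) H_def e_def power2_eq_square power4_eq_xxxx algebra_simps)
    moreover have "card (insert \<one> H) \<le> card H + 1"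
      by (simp add: card_insert_if H(1))
    ultimately have "card (insert \<one> H) \<le> s^2 * e + s^4 + 1"
      by linarith
    then have "card (insert \<one> H \<times> K0) \<le> (s^2 * e + s^4 + 1) * (e * s + 1)"
      unfolding card_cartesian_product K0(3) by (rule mult_le_mono1)
    moreover have "card K \<le> card (insert \<one> H \<times> K0)"
      unfolding K_def by (intro card_image_le finite_cartesian_product) (simp_all add: H K0)
    ultimately have "card K \<le> (s^2 * e + s^4 + 1) * (e * s + 1)"
      by (rule order_trans[rotated])
    also have "\<dots> \<le> (3 * (s^4 * e)) * (2 * (e * s))"
    proof (rule mult_le_mono)
      have "s^2 * e \<le> s^4 * e" using s1 by (simp add: power_increasing)
      moreover have "s^4 * 1 \<le> s^4 * e" using e by (intro mult_le_mono) auto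
      moreover have "1 * 1 \<le> s^4 * e" using e s1 by (intro mult_le_mono) (auto simp: one_le_power)
      ultimately show "s^2 * e + s^4 + 1 \<le> 3 * (s^4 * e)" by linarith
      have "1 * 1 \<le> e * s" using e s1 by (intro mult_le_mono)
      then show "e * s + 1 \<le> 2 * (e * s)" by linarith
    qed
    also have "\<dots> = 6 * e^2 * s^5"
      by (simp add: power_numeral_reduce mult_ac)
    finally have "2 * card K < 2 ^ r"
      using r by (simp add: s_def)
    moreover have "card C \<le> card K + card K"
      unfolding C_def by (rule order_trans[OF card_Un_le]) (intro add_mono card_image_le K)
    moreover have "card (S - B) = r"
      using S B finite_subset[OF B(1) S(2)] by (simp add: card_Diff_subset s_def)
    ultimately show ?thesis
      using S(2) by (simp add: card_Pow)
  qed
  obtain \<phi> :: "'x \<Rightarrow> 'g set" where \<phi>: "\<And>x. x \<in> topspace X \<Longrightarrow> \<phi> x \<in> Pow (S - B)"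
    "\<And>c. clopenin X {x \<in> topspace X. \<phi> x = c}"
    "\<And>x h. x \<in> topspace X \<Longrightarrow> h \<in> C \<Longrightarrow> \<phi> (h \<cdot> x) \<noteq> \<phi> x"
    by (rule clopen_proper_colouring[OF C C1 Cinv _ card_C]) (use S(2) in auto)
  have "\<exists>M Z. marker_level D E \<gamma> S B K Q M Z" if Q: "clopenin X Q" "separated E' Q" for Q
  proof -
    have QX: "Q \<subseteq> topspace X" by (rule clopenin_subset[OF Q(1)])
    have card_LK: "card L < card K0" using card_L K0(3) by simp
    obtain M where M: "clopenin X M" "separated H M" "\<And>y g. y \<in> M \<Longrightarrow> g \<in> L \<Longrightarrow> g \<cdot> y \<notin> Q"
      "\<And>x. x \<in> topspace X \<Longrightarrow> \<exists>h\<in>insert \<one> H. \<exists>k\<in>K0. h \<cdot> k \<cdot> x \<in> M"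
    proof (rule clopen_markers[OF H Hinv L K0(2,1) card_LK E'1 Q])
    qed (assumption | blast)+
    have MX: "M \<subseteq> topspace X" by (rule clopenin_subset[OF M(1)])
    have MX': "y \<in> topspace X" if "y \<in> M" for y using that MX by blast
    have unique: "y' = y \<and> s' = s"
      if "y \<in> M" "y' \<in> M" "s \<in> S" "s' \<in> S" "e \<in> E0" "s' \<cdot> y' = e \<cdot> s \<cdot> y" for y y' s s' e
    proof -
      have c: "s \<in> carrier \<Gamma>" "s' \<in> carrier \<Gamma>" "e \<in> carrier \<Gamma>" "y \<in> topspace X" "y' \<in> topspace X"
        using that Sc E0c MX' by auto
      have "y' = inv s' \<cdot> s' \<cdot> y'"
        using c by simp
      then have "y' = (inv s' \<otimes> e \<otimes> s) \<cdot> y"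
        using that(6) c by (simp add: act_mult)
      then have "y' = y"
        using separatedD[OF M(2) that(1) H1I[OF that(4,5,3)]] that(2) by simp
      moreover have "s' \<cdot> y' = (e \<otimes> s) \<cdot> y"
        using that(6) c by (simp add: act_mult)
      ultimately have "s' = e \<otimes> s"
        using c by (intro act_inj[OF c(4)]) simp_all
      then have "s' = s" using sep that by blast
      with \<open>y' = y\<close> show ?thesis by simp
    qed
    have unique1: "y' = y \<and> s' = s"
      if "y \<in> M" "y' \<in> M" "s \<in> S" "s' \<in> S" "s' \<cdot> y' = s \<cdot> y" for y y' s s'
      using unique[OF that(1-4) E0(4)] that act_one[of "s \<cdot> y"] MX' Sc by simp
    have notQ: "e \<cdot> s \<cdot> y \<notin> Q" if "y \<in> M" "s \<in> S" "e \<in> E0" for y s e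
      using M(3)[OF that(1) LI[OF that(3,2)]] that MX' Sc E0c by (simp add: act_mult)
    define T where "T t = M \<inter> {x \<in> topspace X. t \<in> \<phi> x}" for t
    have T: "clopenin X (T t)" for t
    proof -
      have "{x \<in> topspace X. t \<in> \<phi> x} = (\<Union>c\<in>{c \<in> Pow (S - B). t \<in> c}. {x \<in> topspace X. \<phi> x = c})"
        using \<phi>(1) by auto
      moreover have "clopenin X \<dots>"
        using \<phi>(2) S(2) by (intro clopenin_UN) auto
      ultimately show ?thesis
        using M(1) by (simp add: T_def clopenin_Int)
    qed
    define Z where "Z = translates B M \<union> (\<Union>t\<in>S - B. act t ` T t)"
    have clZ: "clopenin X Z"
      unfolding Z_def using S B M(1) T finite_subset[OF B(1) S(2)]
      by (intro clopenin_Un clopenin_translates clopenin_UN clopenin_image_act) auto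
    have ZS: "Z \<subseteq> translates S M"
      using B(1) by (auto simp: Z_def translates_def T_def)
    have bit: "t \<cdot> y \<in> Z \<longleftrightarrow> t \<in> \<phi> y" if y: "y \<in> M" and t: "t \<in> S - B" for t y
    proof
      assume "t \<cdot> y \<in> Z"
      then consider b y' where "b \<in> B" "y' \<in> M" "t \<cdot> y = b \<cdot> y'"
        | t' y' where "t' \<in> S - B" "y' \<in> T t'" "t \<cdot> y = t' \<cdot> y'"
        unfolding Z_def translates_def by blast
      then show "t \<in> \<phi> y"
      proof cases
        case 1
        then show ?thesis using unique1[of y' y b t] y t B(1) by blast
      next
        case 2
        then have "y = y'" "t = t'"
          using unique1[of y' y t' t] y t by (auto simp: T_def)
        then show ?thesis using 2 by (simp add: T_def)
      qed
    next
      assume "t \<in> \<phi> y"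
      then show "t \<cdot> y \<in> Z"
        using y t MX' by (auto simp: Z_def T_def)
    qed
    have "separated E0 (Q \<union> translates S M)"
      unfolding separated_def
    proof (intro ballI impI)
      fix x e assume x: "x \<in> Q \<union> translates S M" and e: "e \<in> E0" and ex: "e \<cdot> x \<in> Q \<union> translates S M"
      consider "x \<in> Q" "e \<cdot> x \<in> Q"
        | s y where "x \<in> Q" "s \<in> S" "y \<in> M" "e \<cdot> x = s \<cdot> y"
        | s y where "s \<in> S" "y \<in> M" "x = s \<cdot> y" "e \<cdot> s \<cdot> y \<in> Q"
        | s y s' y' where "s \<in> S" "y \<in> M" "x = s \<cdot> y" "s' \<in> S" "y' \<in> M" "s' \<cdot> y' = e \<cdot> s \<cdot> y"
        using x ex unfolding translates_def by fastforce
      then show "e \<cdot> x = x"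
      proof cases
        case 1
        then show ?thesis using separatedD[OF Q(2)] e by (auto simp: E'_def)
      next
        case 2
        then have "x = inv e \<cdot> s \<cdot> y"
          using QX e E0c by (metis act_inv subsetD)
        then show ?thesis using notQ[of y s "inv e"] 2 e E0(5) by simp
      next
        case 3
        then show ?thesis using notQ e by blast
      next
        case 4
        then show ?thesis using unique[of y y' s s' e] e by auto
      qed
    qed
    moreover have "E \<subseteq> E0"
      using E0(3) by (simp add: F_def)
    ultimately have sepE: "separated E (Q \<union> translates S M)"
      by (rule separated_mono)
    have disj: "translates D Q \<inter> translates S M = {}"
    proof -
      have "d \<cdot> q \<noteq> s \<cdot> y" if "d \<in> D" "q \<in> Q" "s \<in> S" "y \<in> M" for d q s y
      proof
        assume "d \<cdot> q = s \<cdot> y"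
        then have "q = inv d \<cdot> s \<cdot> y"
          using that D QX by (metis act_inv subsetD)
        then show False
          using notQ[of y s "inv d"] that DE0(1) E0(5) by metis
      qed
      then show ?thesis by (auto simp: translates_def)
    qed
    have BZ: "translates B M \<subseteq> Z" by (simp add: Z_def)
    have recog: "z \<in> M" if "z \<in> topspace X" "\<forall>b\<in>B. b \<cdot> z \<in> Z \<union> translates D Q" for z
      by (rule marker_recognition[OF S(1,2) gen _ D(2) B MX M(2) H2I QX Q(2) E'2 that(1)])
        (use that ZS sep DE0 in auto)
    have break_at: "\<exists>w\<in>K. w \<cdot> x \<in> M \<and>
        (w \<cdot> \<gamma> \<cdot> x \<in> M \<longrightarrow> (\<exists>t\<in>S. (t \<cdot> w \<cdot> x \<in> Z) \<noteq> (t \<cdot> w \<cdot> \<gamma> \<cdot> x \<in> Z)))"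
      if x: "x \<in> topspace X" for x
    proof -
      obtain h k where hk: "h \<in> insert \<one> H" "k \<in> K0" "h \<cdot> k \<cdot> x \<in> M"
        using M(4)[OF x] by blast
      define w where "w = h \<otimes> k"
      have w: "w \<in> K"
        unfolding w_def K_def by (rule image_eqI[of _ _ "(h, k)"]) (use hk in auto)
      have "h \<in> carrier \<Gamma>" "k \<in> carrier \<Gamma>"
        using hk H K0 by auto
      then have wx: "w \<cdot> x \<in> M"
        using hk(3) x by (simp add: w_def act_mult)
      have "\<exists>t\<in>S. (t \<cdot> w \<cdot> x \<in> Z) \<noteq> (t \<cdot> w \<cdot> \<gamma> \<cdot> x \<in> Z)" if w': "w \<cdot> \<gamma> \<cdot> x \<in> M"
      proof -
        have "w \<cdot> \<gamma> \<cdot> x = (w \<otimes> \<gamma> \<otimes> inv w) \<cdot> w \<cdot> x"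
          using x \<gamma> Kc[OF w] by (simp add: act_mult)
        moreover have "w \<otimes> \<gamma> \<otimes> inv w \<in> C"
          using w by (simp add: C_def)
        ultimately have "\<phi> (w \<cdot> \<gamma> \<cdot> x) \<noteq> \<phi> (w \<cdot> x)"
          using \<phi>(3)[of "w \<cdot> x"] MX' wx by simp
        moreover have "\<phi> (w \<cdot> \<gamma> \<cdot> x) \<subseteq> S - B" "\<phi> (w \<cdot> x) \<subseteq> S - B"
          using \<phi>(1) MX' wx w' by blast+
        ultimately obtain t where "t \<in> S - B" "(t \<in> \<phi> (w \<cdot> x)) \<noteq> (t \<in> \<phi> (w \<cdot> \<gamma> \<cdot> x))"
          by blast
        then show ?thesis
          using bit wx w' by blast
      qed
      then show ?thesis using w wx by blast
    qed
    have "marker_level D E \<gamma> S B K Q M Z"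
      unfolding marker_level_def
      using M(1) clZ ZS sepE disj BZ recog break_at by (intro conjI ballI impI) simp_all
    then show ?thesis by blast
  qed
  then show ?thesis
    using that[OF S(2,1) B(1) K E'] by blast
qed

end

section \<open>Stacking the levels\<close>

context free_zero_dimensional_action
begin

text \<open>
  In terms of the code \<open>g \<mapsto> (g \<cdot> x \<in> c)\<close> of a point \<open>x\<close>: no code agrees on the window \<open>W\<close> with its
  translate by \<open>\<gamma>\<close>, so the window witnesses that \<open>\<gamma>\<close> does not fix the code.
\<close>

definition breaks :: "'x set \<Rightarrow> 'g \<Rightarrow> 'g set \<Rightarrow> bool" where
  "breaks c \<gamma> W \<longleftrightarrow> (\<forall>x\<in>topspace X. \<exists>w\<in>W. (w \<cdot> x \<in> c) \<noteq> (w \<cdot> \<gamma> \<cdot> x \<in> c))"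

text \<open>
  Membership in \<open>P\<close> can be read off from \<open>c\<close> through the window \<open>V\<close>.  The implication suffices,
  the condition being symmetric in \<open>x\<close> and \<open>y\<close>.
\<close>

definition decided_by :: "'g set \<Rightarrow> 'x set \<Rightarrow> 'x set \<Rightarrow> bool" where
  "decided_by V c P \<longleftrightarrow> (\<forall>x\<in>topspace X. \<forall>y\<in>topspace X.
     (\<forall>v\<in>V. v \<cdot> x \<in> c \<longleftrightarrow> v \<cdot> y \<in> c) \<longrightarrow> x \<in> P \<longrightarrow> y \<in> P)"

text \<open>
  The invariant of the construction: whatever bits \<open>P\<close> are prescribed around a sufficiently sparse
  set \<open>Q\<close>, they extend to a clopen set \<open>c\<close> that breaks all the pairs in \<open>R\<close>, and the prescribed
  bits remain recognisable in \<open>c\<close>.  The windows in \<open>R\<close> and the decision window \<open>V\<close> are uniform in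
  \<open>Q\<close> and \<open>P\<close>; this is what allows further levels to be added on top without changing them.
\<close>

definition extendable :: "'g set \<Rightarrow> 'g set \<Rightarrow> 'g set \<Rightarrow> ('g \<times> 'g set) set \<Rightarrow> bool" where
  "extendable D E V R \<longleftrightarrow>
     (\<forall>Q P. clopenin X Q \<longrightarrow> separated E Q \<longrightarrow> clopenin X P \<longrightarrow> P \<subseteq> translates D Q \<longrightarrow>
        (\<exists>c. clopenin X c \<and> c \<inter> translates D Q = P \<and> (\<forall>(\<gamma>, W)\<in>R. breaks c \<gamma> W) \<and> decided_by V c P))"

lemma extendable_empty: "extendable D {} {\<one>} {}"
  unfolding extendable_def
proof (intro allI impI)
  fix Q P assume P: "clopenin X P" "P \<subseteq> translates D Q"
  have "decided_by {\<one>} P P"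
    by (simp add: decided_by_def act_one)
  then show "\<exists>c. clopenin X c \<and> c \<inter> translates D Q = P \<and> (\<forall>(\<gamma>, W)\<in>{}. breaks c \<gamma> W) \<and> decided_by {\<one>} c P"
    using P by (intro exI[of _ P]) auto
qed

lemma decided_byD:
  "decided_by V c P \<Longrightarrow> x \<in> topspace X \<Longrightarrow> y \<in> topspace X \<Longrightarrow>
     (\<And>v. v \<in> V \<Longrightarrow> v \<cdot> x \<in> c \<longleftrightarrow> v \<cdot> y \<in> c) \<Longrightarrow> x \<in> P \<longleftrightarrow> y \<in> P"
  unfolding decided_by_def by metis

text \<open>
  Given \<open>Q\<close> and \<open>P\<close>, a level of markers for \<open>\<gamma>\<close> is placed beside \<open>Q\<close>, and the induction
  hypothesis is applied to the enlarged set of positions \<open>Q \<union> translates S M\<close> with the enlarged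
  set of 1s \<open>P' = P \<union> Z\<close>.  From \<open>c\<close> one can read \<open>P'\<close>, from \<open>P'\<close> the markers \<open>M\<close>, and from \<open>P'\<close> and
  \<open>M\<close> both the bits \<open>Z\<close>, which break \<open>\<gamma>\<close>, and the original \<open>P\<close>.
\<close>

lemma extendable_step:
  assumes D: "finite D" "D \<subseteq> carrier \<Gamma>" "\<one> \<in> D"
    and E: "finite E" "E \<subseteq> carrier \<Gamma>"
    and V: "finite V" "V \<subseteq> carrier \<Gamma>"
    and ext: "extendable D E V R"
    and \<gamma>: "\<gamma> \<in> carrier \<Gamma>" "\<gamma> \<noteq> \<one>"
  obtains E' V' W where "finite E'" "E' \<subseteq> carrier \<Gamma>" "finite V'" "V' \<subseteq> carrier \<Gamma>"
    "finite W" "W \<subseteq> carrier \<Gamma>" "extendable D E' V' (insert (\<gamma>, W) R)"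
proof -
  obtain S B K E' where S: "finite S" "S \<subseteq> carrier \<Gamma>" and B: "B \<subseteq> S"
    and K: "finite K" "K \<subseteq> carrier \<Gamma>" and E': "finite E'" "E' \<subseteq> carrier \<Gamma>"
    and level: "\<And>Q. clopenin X Q \<Longrightarrow> separated E' Q \<Longrightarrow> \<exists>M Z. marker_level D E \<gamma> S B K Q M Z"
    using marker_level_exists[OF D(1,2) E \<gamma>] by metis
  define W where "W = (\<lambda>(v, s, w). v \<otimes> s \<otimes> w) ` (V \<times> S \<times> K)"
  define V' where "V' = V \<union> (\<lambda>(v, b, s). v \<otimes> b \<otimes> inv s) ` (V \<times> S \<times> S)"
  have W: "finite W" "W \<subseteq> carrier \<Gamma>"
    using V S K by (auto simp: W_def subset_iff)
  have V': "finite V'" "V' \<subseteq> carrier \<Gamma>"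
    using V S by (auto simp: V'_def subset_iff)
  have WI: "v \<otimes> s \<otimes> w \<in> W" if "v \<in> V" "s \<in> S" "w \<in> K" for v s w
    unfolding W_def by (rule image_eqI[of _ _ "(v, s, w)"]) (use that in auto)
  have V'I: "v \<otimes> b \<otimes> inv s \<in> V'" if "v \<in> V" "s \<in> S" "b \<in> S" for v b s
    unfolding V'_def by (rule UnI2, rule image_eqI[of _ _ "(v, b, s)"]) (use that in auto)
  have Vc: "v \<in> carrier \<Gamma>" if "v \<in> V" for v using that V by blast
  have Sc: "s \<in> carrier \<Gamma>" if "s \<in> S" for s using that S by blast
  have Kc: "w \<in> carrier \<Gamma>" if "w \<in> K" for w using that K by blast
  have "\<exists>c. clopenin X c \<and> c \<inter> translates D Q = P \<and>
          (\<forall>(g, W)\<in>insert (\<gamma>, W) R. breaks c g W) \<and> decided_by V' c P"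
    if Q: "clopenin X Q" "separated E' Q" and P: "clopenin X P" "P \<subseteq> translates D Q" for Q P
  proof -
    obtain M Z where MZ: "marker_level D E \<gamma> S B K Q M Z"
      using level[OF Q] by blast
    have M: "clopenin X M" and Z: "clopenin X Z" "Z \<subseteq> translates S M"
      and sep: "separated E (Q \<union> translates S M)"
      and disj: "translates D Q \<inter> translates S M = {}"
      and BM: "translates B M \<subseteq> Z"
      and recog: "\<And>z. z \<in> topspace X \<Longrightarrow> (\<forall>b\<in>B. b \<cdot> z \<in> Z \<union> translates D Q) \<Longrightarrow> z \<in> M"
      and break_at: "\<And>x. x \<in> topspace X \<Longrightarrow> \<exists>w\<in>K. w \<cdot> x \<in> M \<and>
        (w \<cdot> \<gamma> \<cdot> x \<in> M \<longrightarrow> (\<exists>t\<in>S. (t \<cdot> w \<cdot> x \<in> Z) \<noteq> (t \<cdot> w \<cdot> \<gamma> \<cdot> x \<in> Z)))"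
      using MZ unfolding marker_level_def by simp_all
    have MX: "M \<subseteq> topspace X" by (rule clopenin_subset[OF M])
    have SMX: "translates S M \<subseteq> topspace X"
      by (rule clopenin_subset[OF clopenin_translates[OF S M]])
    define P' where "P' = P \<union> Z"
    have "translates S M \<subseteq> translates D (Q \<union> translates S M)"
    proof
      fix x assume x: "x \<in> translates S M"
      then have "\<one> \<cdot> x \<in> translates D (Q \<union> translates S M)"
        using D(3) by (intro translatesI) auto
      then show "x \<in> translates D (Q \<union> translates S M)"
        using act_one x SMX by auto
    qed
    then have P': "clopenin X P'" "P' \<subseteq> translates D (Q \<union> translates S M)"
      using P Z unfolding P'_def by (auto intro: clopenin_Un simp: translates_Un)
    have Q': "clopenin X (Q \<union> translates S M)"
      by (intro clopenin_Un clopenin_translates Q M S)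
    obtain c where c: "clopenin X c" "c \<inter> translates D (Q \<union> translates S M) = P'"
      "\<forall>(g, W)\<in>R. breaks c g W" "decided_by V c P'"
      using ext Q' sep P' unfolding extendable_def by blast
    have cP: "c \<inter> translates D Q = P"
    proof -
      have "c \<inter> translates D Q = P' \<inter> translates D Q"
        using c(2) by (auto simp: translates_Un)
      also have "\<dots> = P"
        using P(2) Z(2) disj by (auto simp: P'_def)
      finally show ?thesis .
    qed
    have P'_on_markers: "y \<in> P' \<longleftrightarrow> y \<in> Z" if "y \<in> translates S M" for y
      using that P(2) disj by (auto simp: P'_def)
    have M_iff: "z \<in> M \<longleftrightarrow> (\<forall>b\<in>B. b \<cdot> z \<in> P')" if "z \<in> topspace X" for z
    proof
      assume "z \<in> M"
      then show "\<forall>b\<in>B. b \<cdot> z \<in> P'"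
        using BM by (auto simp: P'_def intro: translatesI)
    next
      assume "\<forall>b\<in>B. b \<cdot> z \<in> P'"
      then show "z \<in> M"
        using recog[OF that] P(2) by (auto simp: P'_def)
    qed
    have "breaks c \<gamma> W"
      unfolding breaks_def
    proof (intro ballI, rule ccontr)
      fix x assume x: "x \<in> topspace X"
        and "\<not> (\<exists>w\<in>W. (w \<cdot> x \<in> c) \<noteq> (w \<cdot> \<gamma> \<cdot> x \<in> c))"
      then have agree: "w \<cdot> x \<in> c \<longleftrightarrow> w \<cdot> \<gamma> \<cdot> x \<in> c" if "w \<in> W" for w
        using that by blast
      obtain w where w: "w \<in> K" "w \<cdot> x \<in> M"
        and t: "w \<cdot> \<gamma> \<cdot> x \<in> M \<Longrightarrow> \<exists>t\<in>S. (t \<cdot> w \<cdot> x \<in> Z) \<noteq> (t \<cdot> w \<cdot> \<gamma> \<cdot> x \<in> Z)"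
        using break_at[OF x] by blast
      have sw: "s \<cdot> w \<cdot> x \<in> P' \<longleftrightarrow> s \<cdot> w \<cdot> \<gamma> \<cdot> x \<in> P'" if s: "s \<in> S" for s
      proof (rule decided_byD[OF c(4)])
        show "s \<cdot> w \<cdot> x \<in> topspace X" "s \<cdot> w \<cdot> \<gamma> \<cdot> x \<in> topspace X"
          using x s Sc Kc w(1) \<gamma> by auto
        fix v assume v: "v \<in> V"
        show "v \<cdot> s \<cdot> w \<cdot> x \<in> c \<longleftrightarrow> v \<cdot> s \<cdot> w \<cdot> \<gamma> \<cdot> x \<in> c"
          using agree[OF WI[OF v s w(1)]] x \<gamma> Vc[OF v] Sc[OF s] Kc[OF w(1)] by (simp add: act_mult)
      qed
      have wx: "w \<cdot> x \<in> topspace X" "w \<cdot> \<gamma> \<cdot> x \<in> topspace X"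
        using x \<gamma> Kc[OF w(1)] by auto
      then have w': "w \<cdot> \<gamma> \<cdot> x \<in> M"
        using M_iff w(2) sw B by blast
      then obtain t where "t \<in> S" "(t \<cdot> w \<cdot> x \<in> Z) \<noteq> (t \<cdot> w \<cdot> \<gamma> \<cdot> x \<in> Z)"
        using t by blast
      then show False
        using sw[of t] P'_on_markers[of "t \<cdot> w \<cdot> x"] P'_on_markers[of "t \<cdot> w \<cdot> \<gamma> \<cdot> x"] w(2) w'
        by (auto intro: translatesI)
    qed
    moreover have "decided_by V' c P"
      unfolding decided_by_def
    proof (intro ballI impI)
      fix x y assume x: "x \<in> topspace X" and y: "y \<in> topspace X" and xP: "x \<in> P"
        and agree: "\<forall>v\<in>V'. v \<cdot> x \<in> c \<longleftrightarrow> v \<cdot> y \<in> c"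
      have "x \<in> P' \<longleftrightarrow> y \<in> P'"
        using agree by (intro decided_byD[OF c(4) x y]) (auto simp: V'_def)
      then have yP': "y \<in> P'"
        using xP by (simp add: P'_def)
      show "y \<in> P"
      proof (rule ccontr)
        assume "y \<notin> P"
        then have "y \<in> translates S M"
          using yP' Z(2) by (auto simp: P'_def)
        then obtain s m where s: "s \<in> S" "m \<in> M" "y = s \<cdot> m"
          by (rule translatesE)
        then have "inv s \<cdot> y \<in> M"
          using MX Sc by auto
        moreover have "b \<cdot> inv s \<cdot> y \<in> P' \<longleftrightarrow> b \<cdot> inv s \<cdot> x \<in> P'" if b: "b \<in> S" for b
        proof (rule decided_byD[OF c(4)])
          show "b \<cdot> inv s \<cdot> y \<in> topspace X" "b \<cdot> inv s \<cdot> x \<in> topspace X"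
            using x y b s Sc by auto
          fix v assume v: "v \<in> V"
          have "(v \<otimes> b \<otimes> inv s) \<cdot> x \<in> c \<longleftrightarrow> (v \<otimes> b \<otimes> inv s) \<cdot> y \<in> c"
            using agree V'I[OF v s(1) b] by blast
          then show "v \<cdot> b \<cdot> inv s \<cdot> y \<in> c \<longleftrightarrow> v \<cdot> b \<cdot> inv s \<cdot> x \<in> c"
            using x y Vc[OF v] Sc[OF s(1)] Sc[OF b] by (simp add: act_mult)
        qed
        ultimately have "inv s \<cdot> x \<in> M"
          using M_iff[of "inv s \<cdot> x"] M_iff[of "inv s \<cdot> y"] x y Sc[OF s(1)] B by auto
        then have "s \<cdot> inv s \<cdot> x \<in> translates S M"
          using s(1) by (intro translatesI)
        then have "x \<in> translates S M"
          using x Sc[OF s(1)] by simp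
        then show False using xP P(2) disj by blast
      qed
    qed
    ultimately show ?thesis
      using c(1,3) cP by (intro exI[of _ c]) auto
  qed
  then have "extendable D E' V' (insert (\<gamma>, W) R)"
    unfolding extendable_def by blast
  then show ?thesis
    using that E' V' W by blast
qed

text \<open>
  The windows \<open>W\<close> do not depend on the number \<open>n\<close> of group elements to be broken; a compactness
  argument will need this.  For given \<open>n\<close>, the topmost set \<open>Q\<close> is a tiny clopen neighbourhood \<open>U\<close> of
  an arbitrary point \<open>z\<close>, and the bits prescribed around it are the pattern \<open>q\<close>.
\<close>

theorem breaking_sets_with_prescribed_pattern:
  fixes \<gamma> :: "nat \<Rightarrow> 'g"
  assumes D: "finite D" "D \<subseteq> carrier \<Gamma>"
    and \<gamma>: "\<And>n. \<gamma> n \<in> carrier \<Gamma> - {\<one>}"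
  obtains W :: "nat \<Rightarrow> 'g set"
  where "\<And>n. finite (W n)" "\<And>n. W n \<subseteq> carrier \<Gamma>"
    "\<And>n q. \<exists>c z. clopenin X c \<and> z \<in> topspace X \<and> (\<forall>m<n. breaks c (\<gamma> m) (W m)) \<and>
        (\<forall>d\<in>D. d \<cdot> z \<in> c \<longleftrightarrow> q d)"
proof -
  define D1 where "D1 = insert \<one> D"
  have D1: "finite D1" "D1 \<subseteq> carrier \<Gamma>" "\<one> \<in> D1"
    using D by (auto simp: D1_def)
  define ok where "ok = (\<lambda>(E, V, R). finite E \<and> E \<subseteq> carrier \<Gamma> \<and> finite V \<and> V \<subseteq> carrier \<Gamma> \<and> extendable D1 E V R)"
  define step where "step = (\<lambda>n (E :: 'g set, V :: 'g set, R) (E' :: 'g set, V' :: 'g set, R').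
      \<exists>W. finite W \<and> W \<subseteq> carrier \<Gamma> \<and> R' = insert (\<gamma> n, W) R)"
  have "\<exists>f. \<forall>n. ok (f n) \<and> step n (f n) (f (Suc n))"
  proof (rule dependent_nat_choice)
    show "\<exists>x. ok x"
      by (rule exI[of _ "({}, {\<one>}, {})"]) (simp add: ok_def extendable_empty)
    show "\<exists>y. ok y \<and> step n x y" if x: "ok x" for x n
    proof -
      obtain E V R where xEV: "x = (E, V, R)" by (cases x)
      have EV: "finite E" "E \<subseteq> carrier \<Gamma>" "finite V" "V \<subseteq> carrier \<Gamma>" "extendable D1 E V R"
        using x by (simp_all add: ok_def xEV)
      have g: "\<gamma> n \<in> carrier \<Gamma>" "\<gamma> n \<noteq> \<one>"
        using \<gamma>[of n] by auto
      obtain E' V' W where "finite E'" "E' \<subseteq> carrier \<Gamma>" "finite V'" "V' \<subseteq> carrier \<Gamma>"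
        "finite W" "W \<subseteq> carrier \<Gamma>" "extendable D1 E' V' (insert (\<gamma> n, W) R)"
        by (rule extendable_step[OF D1 EV g])
      then show ?thesis
        by (intro exI[of _ "(E', V', insert (\<gamma> n, W) R)"]) (auto simp: ok_def step_def xEV)
    qed
  qed
  then obtain f where f: "\<And>n. ok (f n)" "\<And>n. step n (f n) (f (Suc n))" by blast
  define E V R where "E n = fst (f n)" and "V n = fst (snd (f n))" and "R n = snd (snd (f n))" for n
  have fEV: "f n = (E n, V n, R n)" for n
    by (simp add: E_def V_def R_def)
  have EV: "finite (E n)" "E n \<subseteq> carrier \<Gamma>" "extendable D1 (E n) (V n) (R n)" for n
    using f(1)[of n] by (auto simp: ok_def fEV)
  have "\<exists>W. finite W \<and> W \<subseteq> carrier \<Gamma> \<and> R (Suc n) = insert (\<gamma> n, W) (R n)" for n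
    using f(2)[of n] by (simp add: step_def fEV)
  then obtain W where W: "\<And>n. finite (W n)" "\<And>n. W n \<subseteq> carrier \<Gamma>"
    and RS: "\<And>n. R (Suc n) = insert (\<gamma> n, W n) (R n)"
    by metis
  have RI: "(\<gamma> m, W m) \<in> R n" if "m < n" for m n
    using that by (induction n) (auto simp: RS less_Suc_eq)
  have "\<exists>c z. clopenin X c \<and> z \<in> topspace X \<and> (\<forall>m<n. breaks c (\<gamma> m) (W m)) \<and>
        (\<forall>d\<in>D. d \<cdot> z \<in> c \<longleftrightarrow> q d)" for n q
  proof -
    obtain z where z: "z \<in> topspace X"
      using nonempty by blast
    \<comment> \<open>Besides being sparse, \<open>U\<close> must be so small that its translates by different elements of \<open>D\<close>
       are disjoint, for otherwise \<open>q\<close> could not be copied around every point of \<open>U\<close>.\<close>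
    define H where "H = E n \<union> (\<lambda>(d, d'). inv d' \<otimes> d) ` (D \<times> D) - {\<one>}"
    have "finite H" "H \<subseteq> carrier \<Gamma>" "\<one> \<notin> H"
      using EV[of n] D by (auto simp: H_def subset_iff)
    then obtain U where U: "clopenin X U" "z \<in> U" and UH: "\<And>y h. y \<in> U \<Longrightarrow> h \<in> H \<Longrightarrow> h \<cdot> y \<notin> U"
      using small_clopen_nbhd[OF _ _ _ z] by metis
    have UX: "U \<subseteq> topspace X" by (rule clopenin_subset[OF U(1)])
    have sepU: "separated (E n) U"
      unfolding separated_def
    proof (intro ballI impI)
      fix x e assume "x \<in> U" "e \<in> E n" "e \<cdot> x \<in> U"
      then have "e = \<one>" using UH[of x e] by (auto simp: H_def)
      then show "e \<cdot> x = x" using act_one \<open>x \<in> U\<close> UX by blast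
    qed
    define P where "P = translates {d \<in> D. q d} U"
    have "clopenin X P"
      unfolding P_def using D U(1) by (intro clopenin_translates) auto
    moreover have "P \<subseteq> translates D1 U"
      by (auto simp: P_def D1_def translates_def)
    ultimately obtain c where c: "clopenin X c" "c \<inter> translates D1 U = P" "\<forall>(g, W)\<in>R n. breaks c g W"
      using EV(3)[of n] U(1) sepU unfolding extendable_def by blast
    have "d \<cdot> z \<in> c \<longleftrightarrow> q d" if d: "d \<in> D" for d
    proof -
      have dc: "d \<in> carrier \<Gamma>" using d D by blast
      have "d \<cdot> z \<in> translates D1 U"
        using d U(2) by (intro translatesI) (auto simp: D1_def)
      then have "d \<cdot> z \<in> c \<longleftrightarrow> d \<cdot> z \<in> P"
        using c(2) by blast
      also have "\<dots> \<longleftrightarrow> q d"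
      proof
        assume "d \<cdot> z \<in> P"
        then obtain d' u where d': "d' \<in> D" "q d'" "u \<in> U" "d \<cdot> z = d' \<cdot> u"
          unfolding P_def by (auto elim: translatesE)
        have d'c: "d' \<in> carrier \<Gamma>" using d' D by blast
        have u: "u = (inv d' \<otimes> d) \<cdot> z"
          using act_eq_iff[OF z _ dc d'c] d' UX by blast
        have "inv d' \<otimes> d \<notin> H"
          using UH[OF U(2), of "inv d' \<otimes> d"] u d'(3) by auto
        moreover have "inv d' \<otimes> d \<in> (\<lambda>(d, d'). inv d' \<otimes> d) ` (D \<times> D)"
          by (rule image_eqI[of _ _ "(d, d')"]) (use d d' in auto)
        ultimately have "inv d' \<otimes> d = \<one>"
          by (auto simp: H_def)
        then have "inv d' = inv d"
          using dc d'c by (metis inv_closed inv_equality)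
        then have "d' = d"
          using dc d'c by (metis inv_inv)
        then show "q d" using d'(2) by simp
      next
        assume "q d"
        then show "d \<cdot> z \<in> P"
          unfolding P_def using d U(2) by (intro translatesI) auto
      qed
      finally show ?thesis .
    qed
    moreover have "breaks c (\<gamma> m) (W m)" if "m < n" for m
      using c(3) RI[OF that] by blast
    ultimately show ?thesis
      using c(1) z by blast
  qed
  then show ?thesis
    using that W by blast
qed

end

section \<open>The shift and weak containment\<close>

lemma continuous_map_into_discrete:
  "continuous_map X (discrete_topology K) h \<longleftrightarrow>
     (\<forall>x\<in>topspace X. h x \<in> K) \<and> (\<forall>j\<in>K. openin X {x \<in> topspace X. h x = j})" (is "?L \<longleftrightarrow> ?R")
proof
  assume h: ?L
  have "openin X {x \<in> topspace X. h x \<in> {j}}" if "j \<in> K" for j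
    using that by (intro openin_continuous_map_preimage[OF h]) simp
  then show ?R
    using h by (auto simp: continuous_map_def)
next
  assume R: ?R
  have "openin X {x \<in> topspace X. h x \<in> U}" if "U \<subseteq> K" for U
  proof -
    have "{x \<in> topspace X. h x \<in> U} = (\<Union>j\<in>U. {x \<in> topspace X. h x = j})" by auto
    then show ?thesis using R that by (auto intro!: openin_Union)
  qed
  then show ?L using R by (auto simp: continuous_map_def)
qed

text \<open>
  A colouring of a dense subspace extends to a neighbourhood: each colour class is the trace of an
  open set, and by density open sets with disjoint traces are disjoint.
\<close>

lemma continuous_map_dense_subset_extends:
  assumes dense: "T closure_of A = topspace T" and A: "A \<subseteq> topspace T"
    and f: "continuous_map (subtopology T A) (discrete_topology K) f"
  obtains G where "\<And>j. j \<in> K \<Longrightarrow> openin T (G j)" "\<And>i j. i \<in> K \<Longrightarrow> j \<in> K \<Longrightarrow> i \<noteq> j \<Longrightarrow> G i \<inter> G j = {}"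
    "\<And>x j. x \<in> A \<Longrightarrow> j \<in> K \<Longrightarrow> x \<in> G j \<longleftrightarrow> f x = j"
proof -
  have "\<forall>j\<in>K. \<exists>U. openin T U \<and> {x \<in> A. f x = j} = U \<inter> A"
    using f A by (simp add: continuous_map_into_discrete openin_subtopology Int_absorb1)
  then obtain G where G: "\<And>j. j \<in> K \<Longrightarrow> openin T (G j)" "\<And>j. j \<in> K \<Longrightarrow> {x \<in> A. f x = j} = G j \<inter> A"
    by metis
  show ?thesis
  proof (rule that)
    show "G i \<inter> G j = {}" if "i \<in> K" "j \<in> K" "i \<noteq> j" for i j
    proof (rule ccontr)
      assume "G i \<inter> G j \<noteq> {}"
      then have "A \<inter> (G i \<inter> G j) \<noteq> {}"
        using dense that G(1) unfolding dense_intersects_open by blast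
      then obtain x where x: "x \<in> A" "x \<in> G i" "x \<in> G j" by blast
      then have "x \<in> {x \<in> A. f x = i}" "x \<in> {x \<in> A. f x = j}"
        using G(2) that by auto
      then show False using that(3) by simp
    qed
  qed (use G in blast)+
qed

context group
begin

abbreviation "Cantor \<equiv> shift_space G 2"
abbreviation "shift \<equiv> shift_action G 2"
abbreviation "Fr \<equiv> free_part G Cantor shift"

lemma topspace_Cantor: "topspace Cantor = carrier G \<rightarrow>\<^sub>E {..<2}"
  by (simp add: shift_space_def)

lemma shift_apply: "x \<in> topspace Cantor \<Longrightarrow> h \<in> carrier G \<Longrightarrow> shift g x h = x (h \<otimes> g)"
  by (simp add: shift_action_def)

lemma shift_closed: "x \<in> topspace Cantor \<Longrightarrow> g \<in> carrier G \<Longrightarrow> shift g x \<in> topspace Cantor"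
  by (auto simp: shift_action_def topspace_Cantor)

lemma Cantor_eqI:
  "x \<in> topspace Cantor \<Longrightarrow> y \<in> topspace Cantor \<Longrightarrow> (\<And>h. h \<in> carrier G \<Longrightarrow> x h = y h) \<Longrightarrow> x = y"
  unfolding topspace_Cantor by (rule PiE_ext)

lemma shift_mult:
  "x \<in> topspace Cantor \<Longrightarrow> g \<in> carrier G \<Longrightarrow> h \<in> carrier G \<Longrightarrow> shift (g \<otimes> h) x = shift g (shift h x)"
  by (rule Cantor_eqI) (simp_all add: shift_closed shift_apply m_assoc)

lemma shift_one: "x \<in> topspace Cantor \<Longrightarrow> shift \<one> x = x"
  by (rule Cantor_eqI) (simp_all add: shift_closed shift_apply)

lemma Fr_iff: "x \<in> Fr \<longleftrightarrow> x \<in> topspace Cantor \<and> (\<forall>g\<in>carrier G - {\<one>}. shift g x \<noteq> x)"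
  using shift_one by (auto simp: free_part_def stabilizer_def)

lemma shift_Fr:
  assumes x: "x \<in> Fr" and h: "h \<in> carrier G"
  shows "shift h x \<in> Fr"
proof -
  have xC: "x \<in> topspace Cantor" using x by (simp add: Fr_iff)
  have "shift g (shift h x) \<noteq> shift h x" if g: "g \<in> carrier G" "g \<noteq> \<one>" for g
  proof
    assume "shift g (shift h x) = shift h x"
    then have "shift (inv h) (shift g (shift h x)) = shift (inv h) (shift h x)" by simp
    then have "shift (inv h \<otimes> g \<otimes> h) x = x"
      using xC g h shift_one by (simp add: shift_closed m_assoc flip: shift_mult)
    then have "inv h \<otimes> g \<otimes> h = \<one>"
      using x g h unfolding Fr_iff by (metis Diff_iff inv_closed m_closed singletonD)
    then have "h \<otimes> (inv h \<otimes> (g \<otimes> h)) = h"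
      using g h by (simp add: m_assoc)
    then have "g \<otimes> h = h"
      using g h by (simp flip: m_assoc)
    then show False using g h by simp
  qed
  then show ?thesis
    using shift_closed[OF xC h] by (auto simp: Fr_iff)
qed

lemma openin_Cantor:
  "openin Cantor U \<longleftrightarrow> U \<subseteq> topspace Cantor \<and>
     (\<forall>x\<in>U. \<exists>D. finite D \<and> D \<subseteq> carrier G \<and> (\<forall>y\<in>topspace Cantor. (\<forall>d\<in>D. y d = x d) \<longrightarrow> y \<in> U))"
  (is "?L \<longleftrightarrow> ?R")
proof
  assume L: ?L
  have nhd: "\<exists>D. finite D \<and> D \<subseteq> carrier G \<and> (\<forall>y\<in>topspace Cantor. (\<forall>d\<in>D. y d = x d) \<longrightarrow> y \<in> U)"
    if "x \<in> U" for x
  proof -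
    obtain V where V: "finite {i \<in> carrier G. V i \<noteq> {..<2}}" "x \<in> Pi\<^sub>E (carrier G) V"
      "Pi\<^sub>E (carrier G) V \<subseteq> U"
      using bspec[OF L[unfolded shift_space_def openin_product_topology_alt] \<open>x \<in> U\<close>]
      unfolding topspace_discrete_topology by blast
    show ?thesis
    proof (intro exI[of _ "{i \<in> carrier G. V i \<noteq> {..<2}}"] conjI ballI impI)
      fix y assume y: "y \<in> topspace Cantor" "\<forall>d\<in>{i \<in> carrier G. V i \<noteq> {..<2}}. y d = x d"
      have "y i \<in> V i" if "i \<in> carrier G" for i
        using y V(2) that by (cases "V i = {..<2}") (auto simp: topspace_Cantor PiE_iff)
      then have "y \<in> Pi\<^sub>E (carrier G) V"
        using y(1) by (simp add: topspace_Cantor PiE_iff)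
      then show "y \<in> U" using V(3) by blast
    qed (use V in auto)
  qed
  show ?R by (intro conjI ballI openin_subset[OF L] nhd)
next
  assume R: ?R
  show ?L
    unfolding shift_space_def openin_product_topology_alt
  proof
    fix x assume x: "x \<in> U"
    then obtain D where D: "finite D" "D \<subseteq> carrier G"
      "\<And>y. y \<in> topspace Cantor \<Longrightarrow> (\<forall>d\<in>D. y d = x d) \<Longrightarrow> y \<in> U"
      using bspec[OF conjunct2[OF R] x] by blast
    have xC: "x \<in> topspace Cantor" using subsetD[OF conjunct1[OF R] x] .
    let ?V = "\<lambda>i. if i \<in> D then {x i} else {..<2}"
    have x2: "x i < 2" if "i \<in> carrier G" for i
      using xC that by (auto simp: topspace_Cantor)
    have "finite {i \<in> carrier G. ?V i \<noteq> topspace (discrete_topology {..<2})}"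
      by (rule finite_subset[OF _ D(1)]) (auto split: if_splits)
    moreover have "\<forall>i\<in>carrier G. openin (discrete_topology {..<2}) (?V i)"
      using x2 by simp
    moreover have "x \<in> Pi\<^sub>E (carrier G) ?V"
      using xC by (auto simp: topspace_Cantor PiE_iff)
    moreover have "Pi\<^sub>E (carrier G) ?V \<subseteq> U"
    proof
      fix y assume y: "y \<in> Pi\<^sub>E (carrier G) ?V"
      have "y i < 2" if "i \<in> carrier G" for i
        using PiE_mem[OF y that] x2[OF that] by (simp split: if_splits)
      then have "y \<in> topspace Cantor"
        using y by (simp add: topspace_Cantor PiE_iff)
      moreover have "\<forall>d\<in>D. y d = x d"
        using PiE_mem[OF y] D(2) by force
      ultimately show "y \<in> U" by (rule D(3))
    qed
    ultimately show "\<exists>V. finite {i \<in> carrier G. V i \<noteq> topspace (discrete_topology {..<2})} \<and>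
        (\<forall>i\<in>carrier G. openin (discrete_topology {..<2}) (V i)) \<and> x \<in> Pi\<^sub>E (carrier G) V \<and> Pi\<^sub>E (carrier G) V \<subseteq> U"
      by (intro exI[of _ ?V]) blast
  qed
qed

lemma openin_Cantor_window:
  assumes "openin Cantor U" "x \<in> U"
  obtains D where "finite D" "D \<subseteq> carrier G"
    "\<And>y. y \<in> topspace Cantor \<Longrightarrow> (\<And>d. d \<in> D \<Longrightarrow> y d = x d) \<Longrightarrow> y \<in> U"
  using bspec[OF conjunct2[OF iffD1[OF openin_Cantor assms(1)]] assms(2)]
proof (elim exE conjE)
  fix D
  assume D: "finite D" "D \<subseteq> carrier G"
    and U: "\<forall>y\<in>topspace Cantor. (\<forall>d\<in>D. y d = x d) \<longrightarrow> y \<in> U"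
  show thesis
  proof (rule that[OF D])
    fix y assume y: "y \<in> topspace Cantor" "\<And>d. d \<in> D \<Longrightarrow> y d = x d"
    show "y \<in> U"
      by (rule mp[OF bspec[OF U y(1)]]) (rule ballI, rule y(2))
  qed
qed

lemma continuous_map_shift:
  assumes g: "g \<in> carrier G"
  shows "continuous_map Cantor Cantor (shift g)"
proof -
  have "continuous_map Cantor (discrete_topology {..<2}) (\<lambda>x. shift g x h)" if h: "h \<in> carrier G" for h
  proof -
    have "continuous_map Cantor (discrete_topology {..<2}) (\<lambda>x. x (h \<otimes> g))"
      unfolding shift_space_def using g h by (intro continuous_map_product_projection) simp
    then show ?thesis
      by (rule continuous_map_eq) (simp add: shift_apply h)
  qed
  moreover have "shift g ` topspace Cantor \<subseteq> extensional (carrier G)"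
    using shift_closed[OF _ g] by (auto simp: topspace_Cantor PiE_iff)
  ultimately have "continuous_map Cantor (product_topology (\<lambda>_. discrete_topology {..<2}) (carrier G)) (shift g)"
    by (simp add: continuous_map_componentwise)
  then show ?thesis by (simp add: shift_space_def)
qed

text \<open>
  Baire category.  A point moved by \<open>g\<close> exists in every cylinder: beyond the finite set of
  fixed coordinates there is room for two different bits at \<open>w\<close> and \<open>w \<otimes> g\<close>.
\<close>

lemma Fr_dense:
  assumes inf: "infinite (carrier G)" and count: "countable (carrier G)"
  shows "Cantor closure_of Fr = topspace Cantor"
proof -
  define N where "N g = {x \<in> topspace Cantor. shift g x \<noteq> x}" for g
  have N: "openin Cantor (N g) \<and> Cantor closure_of (N g) = topspace Cantor"
    if g: "g \<in> carrier G" "g \<noteq> \<one>" for g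
  proof
    show "openin Cantor (N g)"
      unfolding openin_Cantor
    proof (intro conjI ballI)
      fix x assume "x \<in> N g"
      then have x: "x \<in> topspace Cantor" "shift g x \<noteq> x" by (auto simp: N_def)
      obtain h where h: "h \<in> carrier G" "shift g x h \<noteq> x h"
        using Cantor_eqI[OF shift_closed[OF x(1) g(1)] x(1)] x(2) by blast
      have "y \<in> N g" if "y \<in> topspace Cantor" "\<forall>d\<in>{h, h \<otimes> g}. y d = x d" for y
        using that h shift_apply[OF x(1) h(1), of g] shift_apply[OF that(1) h(1), of g]
        by (auto simp: N_def)
      then show "\<exists>D. finite D \<and> D \<subseteq> carrier G \<and> (\<forall>y\<in>topspace Cantor. (\<forall>d\<in>D. y d = x d) \<longrightarrow> y \<in> N g)"
        using g h by (intro exI[of _ "{h, h \<otimes> g}"]) auto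
    qed (auto simp: N_def)
    have "N g \<inter> T \<noteq> {}" if T: "openin Cantor T" "T \<noteq> {}" for T
    proof -
      obtain x where x: "x \<in> T" using T(2) by blast
      obtain D where D: "finite D" "D \<subseteq> carrier G"
        "\<And>y. y \<in> topspace Cantor \<Longrightarrow> (\<And>d. d \<in> D \<Longrightarrow> y d = x d) \<Longrightarrow> y \<in> T"
        by (rule openin_Cantor_window[OF T(1) x]) blast
      have xC: "x \<in> topspace Cantor" using T(1) x openin_subset by blast
      have "finite (D \<union> (\<lambda>d. d \<otimes> inv g) ` D)" using D(1) by simp
      then obtain w where w: "w \<in> carrier G" "w \<notin> D \<union> (\<lambda>d. d \<otimes> inv g) ` D"
        using inf by (meson finite_subset subsetI)
      have wg: "w \<otimes> g \<notin> D"
      proof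
        assume "w \<otimes> g \<in> D"
        then have "(w \<otimes> g) \<otimes> inv g \<in> (\<lambda>d. d \<otimes> inv g) ` D" by (rule imageI)
        then show False using w g by (simp add: m_assoc)
      qed
      have ne: "w \<otimes> g \<noteq> w" using w(1) g by simp
      define y where "y = x(w := 0, w \<otimes> g := 1)"
      have y: "y \<in> topspace Cantor"
        using xC w(1) g(1) by (auto simp: y_def topspace_Cantor PiE_iff extensional_def)
      have "y d = x d" if "d \<in> D" for d using that w(2) wg by (auto simp: y_def)
      then have "y \<in> T" using D(3)[OF y] by blast
      moreover have "shift g y w \<noteq> y w"
        using y w(1) ne by (simp add: shift_apply) (simp add: y_def)
      then have "y \<in> N g" using y by (auto simp: N_def)
      ultimately show ?thesis by blast
    qed
    then show "Cantor closure_of (N g) = topspace Cantor"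
      unfolding dense_intersects_open by blast
  qed
  have "completely_metrizable_space Cantor"
    unfolding shift_space_def completely_metrizable_space_product_topology
    using count by (auto simp: completely_metrizable_space_discrete_topology intro: countable_subset)
  then have "Cantor closure_of (\<Inter>(N ` (carrier G - {\<one>}))) = topspace Cantor"
    using count N by (intro Baire_category) auto
  moreover have "\<Inter>(N ` (carrier G - {\<one>})) = Fr"
  proof -
    have "carrier G - {\<one>} \<noteq> {}"
      using inf by (metis finite.emptyI finite_Diff2 finite.insertI)
    then show ?thesis
      by (auto simp: N_def Fr_iff)
  qed
  ultimately show ?thesis by simp
qed

text \<open>
  Topological transitivity of the shift in finitary form: a finite pattern that forces the orbit of
  every extension to visit finitely many given open sets.  Patterns forcing the individual
  visits are placed next to each other, at translates disjoint from what is already fixed.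
\<close>

lemma pattern_forcing_visits:
  assumes inf: "infinite (carrier G)" and fin: "finite \<U>"
    and \<U>: "\<And>U. U \<in> \<U> \<Longrightarrow> openin Cantor U \<and> U \<noteq> {}"
  shows "\<exists>D x. finite D \<and> D \<subseteq> carrier G \<and> x \<in> topspace Cantor \<and>
           (\<forall>y\<in>topspace Cantor. (\<forall>d\<in>D. y d = x d) \<longrightarrow> (\<forall>U\<in>\<U>. \<exists>g\<in>carrier G. shift g y \<in> U))"
  using fin \<U>
proof (induction \<U> rule: finite_induct)
  case empty
  have "(\<lambda>g\<in>carrier G. 0) \<in> topspace Cantor"
    by (auto simp: topspace_Cantor)
  then show ?case
    by (metis empty_iff empty_subsetI finite.emptyI)
next
  case (insert U \<U>)
  then obtain D x where D: "finite D" "D \<subseteq> carrier G" and x: "x \<in> topspace Cantor"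
    and visit: "\<And>y V. y \<in> topspace Cantor \<Longrightarrow> (\<And>d. d \<in> D \<Longrightarrow> y d = x d) \<Longrightarrow> V \<in> \<U> \<Longrightarrow> \<exists>g\<in>carrier G. shift g y \<in> V"
    by (metis insertCI)
  have U: "openin Cantor U" "U \<noteq> {}" using insert.prems by auto
  then obtain u where u: "u \<in> U" by blast
  obtain V where V: "finite V" "V \<subseteq> carrier G"
    "\<And>y. y \<in> topspace Cantor \<Longrightarrow> (\<And>d. d \<in> V \<Longrightarrow> y d = u d) \<Longrightarrow> y \<in> U"
    by (rule openin_Cantor_window[OF U(1) u]) blast
  have uC: "u \<in> topspace Cantor" using u U(1) openin_subset by blast
  have "finite ((\<lambda>(v, d). inv v \<otimes> d) ` (V \<times> D))" using V D by simp
  then obtain t where t: "t \<in> carrier G" "t \<notin> (\<lambda>(v, d). inv v \<otimes> d) ` (V \<times> D)"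
    using inf by (meson finite_subset subsetI)
  have vt: "v \<otimes> t \<notin> D" if v: "v \<in> V" for v
  proof
    assume d: "v \<otimes> t \<in> D"
    have "t = inv v \<otimes> (v \<otimes> t)"
      using v V(2) t(1) by (simp add: subset_iff flip: m_assoc)
    then have "t \<in> (\<lambda>(v, d). inv v \<otimes> d) ` (V \<times> D)"
      using v d by (intro image_eqI[of _ _ "(v, v \<otimes> t)"]) auto
    with t(2) show False ..
  qed
  define x' where "x' = (\<lambda>h\<in>carrier G. if h \<in> D then x h else u (h \<otimes> inv t))"
  have x'C: "x' \<in> topspace Cantor"
    using x uC t(1) by (auto simp: x'_def topspace_Cantor PiE_iff)
  let ?D' = "D \<union> (\<lambda>v. v \<otimes> t) ` V"
  have "\<exists>g\<in>carrier G. shift g y \<in> W"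
    if y: "y \<in> topspace Cantor" "\<forall>d\<in>?D'. y d = x' d" and W: "W \<in> insert U \<U>" for y W
  proof (cases "W = U")
    case True
    have "shift t y v = u v" if v: "v \<in> V" for v
    proof -
      have vc: "v \<in> carrier G" using v V(2) by blast
      have "shift t y v = x' (v \<otimes> t)" using y v vc by (simp add: shift_apply)
      also have "\<dots> = u v" using vt[OF v] vc t(1) by (simp add: x'_def m_assoc)
      finally show ?thesis .
    qed
    then have "shift t y \<in> U" using V(3)[OF shift_closed[OF y(1) t(1)]] by blast
    then show ?thesis using t(1) True by blast
  next
    case False
    have "y d = x d" if "d \<in> D" for d
      using y(2) that D(2) by (auto simp: x'_def)
    then show ?thesis using visit[OF y(1)] W False by blast
  qed
  moreover have "finite ?D'" "?D' \<subseteq> carrier G"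
    using D V t(1) by auto
  ultimately show ?case
    using x'C by (intro exI[of _ ?D'] exI[of _ x']) blast
qed

end

context free_zero_dimensional_action
begin

definition coding :: "'x set \<Rightarrow> 'x \<Rightarrow> 'g \<Rightarrow> nat" where
  "coding c x = (\<lambda>g\<in>carrier \<Gamma>. if g \<cdot> x \<in> c then 1 else 0)"

lemma coding_in_Cantor: "coding c x \<in> topspace Cantor"
  by (auto simp: coding_def topspace_Cantor)

lemma coding_equivariant:
  "x \<in> topspace X \<Longrightarrow> g \<in> carrier \<Gamma> \<Longrightarrow> coding c (g \<cdot> x) = shift g (coding c x)"
  by (rule Cantor_eqI) (simp_all add: coding_in_Cantor shift_closed shift_apply, simp add: coding_def act_mult)

lemma continuous_map_coding:
  assumes c: "clopenin X c"
  shows "continuous_map X Cantor (coding c)"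
proof -
  have "continuous_map X (discrete_topology {..<2}) (\<lambda>x. coding c x g)" if g: "g \<in> carrier \<Gamma>" for g
  proof -
    have "clopenin X {x \<in> topspace X. g \<cdot> x \<in> c}"
      by (rule clopenin_preimage_act[OF g c])
    then have "openin X {x \<in> topspace X. g \<cdot> x \<in> c}"
      "openin X (topspace X - {x \<in> topspace X. g \<cdot> x \<in> c})"
      by (auto simp: clopenin_def)
    moreover have "{x \<in> topspace X. coding c x g = j} =
        (if j = 0 then topspace X - {x \<in> topspace X. g \<cdot> x \<in> c} else {x \<in> topspace X. g \<cdot> x \<in> c})"
      if "j < 2" for j
      using that g by (auto simp: coding_def split: if_splits)
    ultimately show ?thesis
      using g unfolding continuous_map_into_discrete by (auto simp: coding_def)
  qed
  moreover have "coding c ` topspace X \<subseteq> extensional (carrier \<Gamma>)"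
    by (auto simp: coding_def)
  ultimately have "continuous_map X (product_topology (\<lambda>_. discrete_topology {..<2}) (carrier \<Gamma>)) (coding c)"
    by (simp add: continuous_map_componentwise)
  then show ?thesis by (simp add: shift_space_def)
qed

text \<open>
  No code needs to lie in \<open>Fr\<close> itself.  With \<open>A m\<close> the set of points whose translate by \<open>\<gamma> m\<close> agrees
  with them on \<open>W m\<close>, a point outside \<open>Fr\<close> lies in some \<open>A m\<close>; by compactness \<open>\<Omega>\<close> and finitely
  many of the \<open>A m\<close> cover everything, and a set \<open>c\<close> breaking the corresponding \<open>\<gamma> m\<close> has its
  codes outside these \<open>A m\<close>.
\<close>

lemma coding_into_neighbourhood_of_Fr:
  assumes count: "countable (carrier \<Gamma>)"
    and D: "finite D" "D \<subseteq> carrier \<Gamma>" and q: "q \<in> topspace Cantor"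
    and \<Omega>: "openin Cantor \<Omega>" "Fr \<subseteq> \<Omega>"
  obtains c z where "clopenin X c" "z \<in> topspace X" "\<And>x. x \<in> topspace X \<Longrightarrow> coding c x \<in> \<Omega>"
    "\<And>d. d \<in> D \<Longrightarrow> coding c z d = q d"
proof -
  have "carrier \<Gamma> - {\<one>} \<noteq> {}"
    using infinite_group by (metis finite.emptyI finite_Diff2 finite.insertI)
  then obtain \<gamma> :: "nat \<Rightarrow> 'g" where \<gamma>: "range \<gamma> = carrier \<Gamma> - {\<one>}"
    using count by (metis countable_Diff range_from_nat_into)
  have \<gamma>n: "\<gamma> n \<in> carrier \<Gamma> - {\<one>}" for n
    using \<gamma> by blast
  obtain W :: "nat \<Rightarrow> 'g set" where W: "\<And>n. finite (W n)" "\<And>n. W n \<subseteq> carrier \<Gamma>"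
    and core: "\<And>n q. \<exists>c z. clopenin X c \<and> z \<in> topspace X \<and> (\<forall>m<n. breaks c (\<gamma> m) (W m)) \<and>
        (\<forall>d\<in>D. d \<cdot> z \<in> c \<longleftrightarrow> q d)"
    using breaking_sets_with_prescribed_pattern[of D \<gamma>, OF D \<gamma>n] by blast
  define A where "A m = {y \<in> topspace Cantor. \<forall>w\<in>W m. y w = y (w \<otimes> \<gamma> m)}" for m
  have A: "openin Cantor (A m)" for m
    unfolding openin_Cantor
  proof (intro conjI ballI)
    fix y assume y: "y \<in> A m"
    let ?D = "W m \<union> (\<lambda>w. w \<otimes> \<gamma> m) ` W m"
    have "y' \<in> A m" if "y' \<in> topspace Cantor" "\<forall>d\<in>?D. y' d = y d" for y'
      using y that by (simp add: A_def)
    moreover have "finite ?D" "?D \<subseteq> carrier \<Gamma>"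
      using W[of m] \<gamma>n[of m] by auto
    ultimately show "\<exists>D. finite D \<and> D \<subseteq> carrier \<Gamma> \<and> (\<forall>y'\<in>topspace Cantor. (\<forall>d\<in>D. y' d = y d) \<longrightarrow> y' \<in> A m)"
      by (intro exI[of _ ?D]) blast
  qed (auto simp: A_def)
  have cover: "y \<in> \<Omega> \<or> (\<exists>m. y \<in> A m)" if y: "y \<in> topspace Cantor" for y
  proof (cases "y \<in> Fr")
    case True
    then show ?thesis using \<Omega>(2) by blast
  next
    case False
    then obtain m where "shift (\<gamma> m) y = y"
      using y \<gamma> unfolding Fr_iff by (metis imageE)
    then have "y w = y (w \<otimes> \<gamma> m)" if "w \<in> carrier \<Gamma>" for w
      using shift_apply[OF y that, of "\<gamma> m"] by simp
    then have "y \<in> A m"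
      using y W(2) by (auto simp: A_def)
    then show ?thesis by blast
  qed
  have "compact_space Cantor"
    unfolding shift_space_def by (simp add: compact_space_product_topology compact_space_discrete_topology)
  moreover have "topspace Cantor \<subseteq> \<Union>(insert \<Omega> (range A))"
    using cover by blast
  moreover have "\<forall>U\<in>insert \<Omega> (range A). openin Cantor U"
    using \<Omega>(1) A by auto
  ultimately obtain \<F> where \<F>: "finite \<F>" "\<F> \<subseteq> insert \<Omega> (range A)" "topspace Cantor \<subseteq> \<Union>\<F>"
    unfolding compact_space_alt by (metis (no_types, lifting))
  have "finite (\<F> - {\<Omega>})" "\<F> - {\<Omega>} \<subseteq> range A"
    using \<F> by auto
  then obtain I where I: "finite I" "\<F> - {\<Omega>} = A ` I"
    by (meson finite_subset_image)
  obtain n where n: "\<And>m. m \<in> I \<Longrightarrow> m < n"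
    using I(1) unfolding finite_nat_set_iff_bounded by blast
  obtain c z where c: "clopenin X c" "z \<in> topspace X" "\<And>m. m < n \<Longrightarrow> breaks c (\<gamma> m) (W m)"
    "\<And>d. d \<in> D \<Longrightarrow> d \<cdot> z \<in> c \<longleftrightarrow> q d = 1"
    using core[of n "\<lambda>d. q d = 1"] by blast
  show ?thesis
  proof (rule that)
    fix x assume x: "x \<in> topspace X"
    have "coding c x \<notin> A m" if "m \<in> I" for m
    proof
      assume in_A: "coding c x \<in> A m"
      obtain w where w: "w \<in> W m" "(w \<cdot> x \<in> c) \<noteq> (w \<cdot> \<gamma> m \<cdot> x \<in> c)"
        using c(3)[OF n[OF \<open>m \<in> I\<close>]] x unfolding breaks_def by blast
      have wc: "w \<in> carrier \<Gamma>" "\<gamma> m \<in> carrier \<Gamma>" using w(1) W(2) \<gamma>n[of m] by auto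
      have "coding c x w = coding c x (w \<otimes> \<gamma> m)"
        using in_A w(1) by (simp add: A_def)
      then show False
        using w(2) wc x by (simp add: coding_def act_mult split: if_splits)
    qed
    then have "coding c x \<notin> \<Union>(\<F> - {\<Omega>})"
      using I(2) by auto
    then show "coding c x \<in> \<Omega>"
      using \<F>(3) coding_in_Cantor[of c x] by blast
  next
    fix d assume d: "d \<in> D"
    have dc: "d \<in> carrier \<Gamma>" using d D by blast
    then have "q d < 2" using q by (auto simp: topspace_Cantor)
    then show "coding c z d = q d"
      using c(4)[OF d] dc by (auto simp: coding_def)
  qed (use c in auto)
qed

text \<open>
  With \<open>G\<close> the extension of \<open>f\<close> to a neighbourhood of \<open>Fr\<close>, let \<open>N p\<close> be the open set of points
  at which \<open>G\<close> shows the pattern \<open>p\<close>.  By density \<open>p\<close> occurs in \<open>f\<close> iff \<open>N p\<close> is nonempty, whereas it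
  occurs in the pulled-back colouring \<open>g\<close> iff some code lies in \<open>N p\<close>.  So \<open>g\<close> shows no new
  patterns, and it shows all of them because the code of \<open>z\<close> is forced to visit every nonempty \<open>N p\<close>.
\<close>

theorem free_part_weakly_contained:
  assumes count: "countable (carrier \<Gamma>)"
  shows "weakly_contained \<Gamma> (free_space \<Gamma> Cantor shift) (induced_action \<Gamma> Cantor shift) X act"
  unfolding weakly_contained_def
proof (intro allI impI, elim conjE)
  fix k :: nat and F :: "'g set" and f
  assume k: "0 < k" and F: "finite F" "F \<subseteq> carrier \<Gamma>"
    and f: "continuous_coloring (free_space \<Gamma> Cantor shift) k f"
  have dense: "Cantor closure_of Fr = topspace Cantor"
    by (rule Fr_dense[OF infinite_group count])
  have FrC: "Fr \<subseteq> topspace Cantor" by (auto simp: Fr_iff)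
  have "continuous_map (subtopology Cantor Fr) (discrete_topology {..<k}) f"
    using f by (simp add: continuous_coloring_def free_space_def)
  then obtain G where G: "\<And>j. j \<in> {..<k} \<Longrightarrow> openin Cantor (G j)"
    and disj: "\<And>i j. i \<in> {..<k} \<Longrightarrow> j \<in> {..<k} \<Longrightarrow> i \<noteq> j \<Longrightarrow> G i \<inter> G j = {}"
    and Gf: "\<And>x j. x \<in> Fr \<Longrightarrow> j \<in> {..<k} \<Longrightarrow> x \<in> G j \<longleftrightarrow> f x = j"
    using continuous_map_dense_subset_extends[OF dense FrC] by metis
  have f_less: "f x < k" if "x \<in> Fr" for x
    using f that FrC by (auto simp: continuous_coloring_def free_space_def continuous_map_def)
  define N where "N p = {y \<in> topspace Cantor. \<forall>\<gamma>\<in>F. shift \<gamma> y \<in> G (the (p \<gamma>))}" for p :: "'g \<rightharpoonup> nat"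
  define \<P> where "\<P> = {p. is_pattern \<Gamma> k p \<and> dom p = F}"
  have val: "the (p \<gamma>) \<in> {..<k}" if "p \<in> \<P>" "\<gamma> \<in> F" for p \<gamma>
    using that by (auto simp: \<P>_def is_pattern_def ran_def)
  have "\<P> = {p. dom p = F \<and> ran p \<subseteq> {..<k}}"
    using F by (auto simp: \<P>_def is_pattern_def)
  then have fin\<P>: "finite \<P>"
    using finite_set_of_finite_maps[OF F(1), of "{..<k}"] by simp
  have N_open: "openin Cantor (N p)" if p: "p \<in> \<P>" for p
  proof -
    have "N p = topspace Cantor \<inter> (\<Inter>\<gamma>\<in>F. {y \<in> topspace Cantor. shift \<gamma> y \<in> G (the (p \<gamma>))})"
      by (auto simp: N_def)
    moreover have "openin Cantor {y \<in> topspace Cantor. shift \<gamma> y \<in> G (the (p \<gamma>))}" if "\<gamma> \<in> F" for \<gamma>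
      using that F(2) G val[OF p that]
      by (intro openin_continuous_map_preimage[OF continuous_map_shift]) auto
    ultimately show ?thesis
      using F(1) by (cases "F = {}") (auto intro!: openin_Int openin_INT)
  qed
  have occurs_f: "pattern_occurs (free_space \<Gamma> Cantor shift) (induced_action \<Gamma> Cantor shift) f p \<longleftrightarrow> N p \<noteq> {}"
    if p: "p \<in> \<P>" for p
  proof -
    have "pattern_occurs (free_space \<Gamma> Cantor shift) (induced_action \<Gamma> Cantor shift) f p \<longleftrightarrow>
        (\<exists>x\<in>Fr. \<forall>\<gamma>\<in>F. f (shift \<gamma> x) = the (p \<gamma>))"
      using p FrC by (auto simp: \<P>_def pattern_occurs_def free_space_def induced_action_def Int_absorb1)
    also have "\<dots> \<longleftrightarrow> (\<exists>x\<in>Fr. \<forall>\<gamma>\<in>F. shift \<gamma> x \<in> G (the (p \<gamma>)))"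
      using Gf shift_Fr val[OF p] F(2) by (intro bex_cong ball_cong refl) auto
    also have "\<dots> \<longleftrightarrow> Fr \<inter> N p \<noteq> {}"
      using FrC by (auto simp: N_def)
    also have "\<dots> \<longleftrightarrow> N p \<noteq> {}"
      using dense N_open[OF p] unfolding dense_intersects_open by blast
    finally show ?thesis .
  qed
  define \<U> where "\<U> = N ` {p \<in> \<P>. N p \<noteq> {}}"
  have "finite \<U>"
    using fin\<P> by (simp add: \<U>_def)
  moreover have "openin Cantor U \<and> U \<noteq> {}" if "U \<in> \<U>" for U
    using that N_open by (auto simp: \<U>_def)
  ultimately have "\<exists>D q. finite D \<and> D \<subseteq> carrier \<Gamma> \<and> q \<in> topspace Cantor \<and>
      (\<forall>y\<in>topspace Cantor. (\<forall>d\<in>D. y d = q d) \<longrightarrow> (\<forall>U\<in>\<U>. \<exists>g\<in>carrier \<Gamma>. shift g y \<in> U))"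
    by (rule pattern_forcing_visits[OF infinite_group])
  then obtain D q where Dq: "finite D \<and> D \<subseteq> carrier \<Gamma> \<and> q \<in> topspace Cantor \<and>
      (\<forall>y\<in>topspace Cantor. (\<forall>d\<in>D. y d = q d) \<longrightarrow> (\<forall>U\<in>\<U>. \<exists>g\<in>carrier \<Gamma>. shift g y \<in> U))"
    by (elim exE) (rule that)
  then have D: "finite D" "D \<subseteq> carrier \<Gamma>" and q: "q \<in> topspace Cantor"
    by simp_all
  have visit: "\<exists>g\<in>carrier \<Gamma>. shift g y \<in> N p"
    if y: "y \<in> topspace Cantor" "\<And>d. d \<in> D \<Longrightarrow> y d = q d" and p: "p \<in> \<P>" "N p \<noteq> {}" for y p
  proof -
    have "\<forall>U\<in>\<U>. \<exists>g\<in>carrier \<Gamma>. shift g y \<in> U"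
      using Dq y by simp
    then show ?thesis using p by (auto simp: \<U>_def)
  qed
  have "openin Cantor (\<Union>j<k. G j)"
    using G by auto
  moreover have "Fr \<subseteq> (\<Union>j<k. G j)"
    using Gf f_less by blast
  ultimately obtain c z where c: "clopenin X c" "z \<in> topspace X"
    and cO: "\<And>x. x \<in> topspace X \<Longrightarrow> coding c x \<in> (\<Union>j<k. G j)"
    and cz: "\<And>d. d \<in> D \<Longrightarrow> coding c z d = q d"
    using coding_into_neighbourhood_of_Fr[OF count D q] by metis
  have "\<exists>j. j < k \<and> coding c x \<in> G j" if "x \<in> topspace X" for x
    using cO[OF that] by blast
  then obtain g where g: "\<And>x. x \<in> topspace X \<Longrightarrow> g x < k" "\<And>x. x \<in> topspace X \<Longrightarrow> coding c x \<in> G (g x)"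
    by metis
  have g_iff: "g x = j \<longleftrightarrow> coding c x \<in> G j" if "x \<in> topspace X" "j < k" for x j
    using g[OF that(1)] disj[of "g x" j] that(2) by auto
  have "continuous_coloring X k g"
    unfolding continuous_coloring_def continuous_map_into_discrete
  proof (intro conjI ballI)
    fix j assume j: "j \<in> {..<k}"
    have "{x \<in> topspace X. g x = j} = {x \<in> topspace X. coding c x \<in> G j}"
      using g_iff j by auto
    then show "openin X {x \<in> topspace X. g x = j}"
      using openin_continuous_map_preimage[OF continuous_map_coding[OF c(1)] G[OF j]] by simp
  qed (use g in auto)
  moreover have occurs_g: "pattern_occurs X act g p \<longleftrightarrow> (\<exists>x\<in>topspace X. coding c x \<in> N p)" if p: "p \<in> \<P>" for p
  proof -
    have "g (\<gamma> \<cdot> x) = the (p \<gamma>) \<longleftrightarrow> shift \<gamma> (coding c x) \<in> G (the (p \<gamma>))"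
      if "x \<in> topspace X" "\<gamma> \<in> F" for x \<gamma>
    proof -
      have "\<gamma> \<in> carrier \<Gamma>" using that F by blast
      then show ?thesis
        using g_iff[of "\<gamma> \<cdot> x" "the (p \<gamma>)"] val[OF p that(2)] that(1) by (simp add: coding_equivariant)
    qed
    then show ?thesis
      using p coding_in_Cantor by (auto simp: pattern_occurs_def \<P>_def N_def)
  qed
  have "pattern_occurs X act g p \<longleftrightarrow> N p \<noteq> {}" if p: "p \<in> \<P>" for p
  proof
    assume "N p \<noteq> {}"
    then obtain h where "h \<in> carrier \<Gamma>" "shift h (coding c z) \<in> N p"
      using visit[OF coding_in_Cantor cz p] by blast
    then have "coding c (h \<cdot> z) \<in> N p"
      using coding_equivariant c(2) by simp
    then show "pattern_occurs X act g p"
      using occurs_g[OF p] c(2) \<open>h \<in> carrier \<Gamma>\<close> act_closed by blast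
  qed (use occurs_g[OF p] in blast)
  then have "patterns \<Gamma> k F X act g = patterns \<Gamma> k F (free_space \<Gamma> Cantor shift) (induced_action \<Gamma> Cantor shift) f"
    using occurs_f unfolding patterns_def \<P>_def by blast
  ultimately show "\<exists>g. continuous_coloring X k g \<and>
      patterns \<Gamma> k F X act g = patterns \<Gamma> k F (free_space \<Gamma> Cantor shift) (induced_action \<Gamma> Cantor shift) f"
    by blast
qed

end

theorem theorem1p11:
  fixes \<Gamma> :: "('g, 'm) monoid_scheme"
    and X :: "'x topology"
    and \<alpha> :: "'g \<Rightarrow> 'x \<Rightarrow> 'x"
  assumes "group \<Gamma>"
    and "countable (carrier \<Gamma>)"
    and "infinite (carrier \<Gamma>)"
    and "gamma_space \<Gamma> X \<alpha>"
    and "free_action \<Gamma> X \<alpha>"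
    and "polish_topology X"
    and "zero_dimensional X"
    and "topspace X \<noteq> {}"
  shows "weakly_contained \<Gamma>
           (free_space \<Gamma> (shift_space \<Gamma> 2) (shift_action \<Gamma> 2))
           (induced_action \<Gamma> (shift_space \<Gamma> 2) (shift_action \<Gamma> 2))
           X \<alpha>"
proof -
  interpret act: group_action \<Gamma> "topspace X" \<alpha>
    using assms(4) by (simp add: gamma_space_def)
  have cont: "continuous_map X X (\<alpha> g)" if "g \<in> carrier \<Gamma>" for g
  proof -
    have "continuous_map X (prod_topology (discrete_topology (carrier \<Gamma>)) X) (\<lambda>x. (g, x))"
      using that by (simp add: continuous_map_pairwise o_def continuous_map_const)
    moreover have "continuous_map (prod_topology (discrete_topology (carrier \<Gamma>)) X) X (\<lambda>(g, x). \<alpha> g x)"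
      using assms(4) by (simp add: gamma_space_def)
    ultimately have "continuous_map X X ((\<lambda>(g, x). \<alpha> g x) \<circ> (\<lambda>x. (g, x)))"
      by (rule continuous_map_compose)
    then show ?thesis by (simp add: o_def)
  qed
  have "Hausdorff_space X"
    using assms(6) by (simp add: polish_topology_def completely_metrizable_imp_metrizable_space
        metrizable_imp_Hausdorff_space)
  moreover have "g = \<one>\<^bsub>\<Gamma>\<^esub>" if "x \<in> topspace X" "g \<in> carrier \<Gamma>" "\<alpha> g x = x" for x g
    using that assms(5) by (auto simp: free_action_def stabilizer_def)
  moreover have "\<alpha> \<one>\<^bsub>\<Gamma>\<^esub> x = x" if "x \<in> topspace X" for x
    using act.id_eq_one that by (metis restrict_apply')
  ultimately interpret free_zero_dimensional_action \<Gamma> X \<alpha>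
    using assms cont act.composition_rule polish_imp_Lindelof_space
    by (intro free_zero_dimensional_action.intro free_zero_dimensional_action_axioms.intro) blast+
  show ?thesis
    by (rule free_part_weakly_contained[OF assms(2)])
qed

end
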